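(* Any pair $(f_0,f_1)\in\operatorname{Hom}(V,W)_X\times\operatorname{Hom}(V,W)_X$ can be connected by a smooth path $\gamma:[0,1]\to\operatorname{Hom}(V,W)$ (with $\gamma(0)=f_0$, $\gamma(1)=f_1$) which intersects the wall $\mathcal{W}_X$ in finitely many regular points, all intersection points being transversal.
   Context: $V$ is a real vector space of finite dimension $N$, $\mathbb{P}(V)$ is the projective space of lines in $V$, $X\subset\mathbb{P}(V)$ is a compact smooth (not necessarily algebraic) submanifold of dimension $m<N-1$, $n:=m+1$, and $W$ is a real vector space of dimension $n$. $Y_X\subset X\times V$ is the rank $n$ subbundle whose fibre $Y_l$ at a line $l\in X$ contains $l$ and is such that, under $T_l\mathbb{P}(V)=\operatorname{Hom}(l,V/l)$, one has $T_lX=\operatorname{Hom}(l,Y_l/l)$. $\operatorname{Hom}(V,W)_X:=\{f\in\operatorname{Hom}(V,W)\mid X\cap\mathbb{P}(\ker f)=\emptyset\}$, and the wall is $\mathcal{W}_X:=\operatorname{Hom}(V,W)\setminus\operatorname{Hom}(V,W)_X$. A point $f\in\mathcal{W}_X$ is called regular if $f$ is surjective, $X\cap\mathbb{P}(\ker f)$ consists of a single point $\xi_f$, and $\ker(f)\cap Y_{\xi_f}=\xi_f$. At every regular point $\mathcal{W}_X$ is a smooth hypersurface of $\operatorname{Hom}(V,W)$, and an intersection of $\gamma$ with $\mathcal{W}_X$ at a regular point $\gamma(t)$ is transversal if $\dot\gamma(t)\notin T_{\gamma(t)}\mathcal{W}_X$. *)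

theory Defs
  imports "HOL-Analysis.Analysis"
begin

section \<open>Smooth maps\<close>

primrec Ck_on :: "nat \<Rightarrow> ('a::euclidean_space \<Rightarrow> 'b::real_normed_vector) \<Rightarrow> 'a set \<Rightarrow> bool" where
  "Ck_on 0 f U \<longleftrightarrow> continuous_on U f"
| "Ck_on (Suc k) f U \<longleftrightarrow>
     (\<forall>x\<in>U. f differentiable (at x)) \<and> (\<forall>v. Ck_on k (\<lambda>x. frechet_derivative f (at x) v) U)"

text \<open>Smoothness on an arbitrary set (closed intervals, relatively open subsets of affine
  subspaces) means having \<open>C\<^sup>\<infinity>\<close> extensions locally around each point. \<open>Ck_on\<close> is only used on
  open sets.\<close>

definition smooth_on :: "'a set \<Rightarrow> ('a::euclidean_space \<Rightarrow> 'b::real_normed_vector) \<Rightarrow> bool" where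
  "smooth_on S f \<longleftrightarrow>
     (\<forall>x\<in>S. \<exists>U g. open U \<and> x \<in> U \<and> (\<forall>k. Ck_on k g U) \<and> (\<forall>y\<in>S \<inter> U. g y = f y))"

section \<open>Submanifolds and tangent vectors in linear spaces\<close>

text \<open>Embedded \<open>d\<close>-dimensional submanifolds \<open>M\<close> of an affine space \<open>A\<close>: locally a diffeomorphism
  between open subsets of \<open>A\<close> straightens \<open>M\<close> to a \<open>d\<close>-dimensional affine subspace.\<close>

definition smooth_submanifold :: "'a::euclidean_space set \<Rightarrow> nat \<Rightarrow> 'a set \<Rightarrow> bool" where
  "smooth_submanifold A d M \<longleftrightarrow> M \<subseteq> A \<and>
     (\<forall>p\<in>M. \<exists>U Q \<phi> \<psi> E.
        openin (top_of_set A) U \<and> p \<in> U \<and> openin (top_of_set A) Q \<and>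
        homeomorphism U Q \<phi> \<psi> \<and> smooth_on U \<phi> \<and> smooth_on Q \<psi> \<and>
        affine E \<and> E \<subseteq> A \<and> aff_dim E = int d \<and> \<phi> ` (M \<inter> U) = E \<inter> Q)"

text \<open>The velocities at \<open>p\<close> of smooth curves in \<open>M\<close>. This is the usual tangent space whenever
  \<open>M\<close> is a submanifold near \<open>p\<close>.\<close>

definition tangent_space :: "'a::real_normed_vector set \<Rightarrow> 'a \<Rightarrow> 'a set" where
  "tangent_space M p =
     {vector_derivative c (at 0) | c. \<exists>\<epsilon>>0. smooth_on {-\<epsilon><..<\<epsilon>} c \<and> c 0 = p \<and>
        c ` {-\<epsilon><..<\<epsilon>} \<subseteq> M}"

section \<open>Projective space\<close>

definition proj :: "'v::euclidean_space set \<Rightarrow> 'v set set" where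
  "proj K = {l. subspace l \<and> dim l = 1 \<and> l \<subseteq> K}"

text \<open>The quotient topology of \<open>V - {0}\<close>.\<close>

definition proj_topology :: "'v::euclidean_space set topology" where
  "proj_topology = topology (\<lambda>G. G \<subseteq> proj UNIV \<and> open (\<Union>G - {0}))"

lemma proj_Int:
  assumes "l \<in> proj UNIV" "l' \<in> proj UNIV" "x \<in> l" "x \<in> l'" "x \<noteq> 0"
  shows "l = l'"
proof -
  have "k = span {x}" if "k \<in> proj UNIV" "x \<in> k" for k
  proof -
    have "subspace k" "dim k = 1" using that by (auto simp: proj_def)
    moreover have "span {x} \<subseteq> k"
      using \<open>subspace k\<close> that(2) by (simp add: span_minimal)
    moreover have "dim (span {x}) = 1"
      using \<open>x \<noteq> 0\<close> by (simp add: dim_insert)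
    ultimately show ?thesis
      by (metis order_refl subspace_dim_equal subspace_span)
  qed
  then show ?thesis using assms by blast
qed

lemma openin_proj_topology:
  "openin proj_topology G \<longleftrightarrow> G \<subseteq> proj UNIV \<and> open (\<Union>G - {0 :: 'v::euclidean_space})"
proof -
  have "istopology (\<lambda>G. G \<subseteq> proj UNIV \<and> open (\<Union>G - {0 :: 'v}))"
    unfolding istopology_def
  proof (intro conjI allI impI)
    fix S T :: "'v set set"
    assume S: "S \<subseteq> proj UNIV \<and> open (\<Union>S - {0})" and T: "T \<subseteq> proj UNIV \<and> open (\<Union>T - {0})"
    have "\<Union>(S \<inter> T) - {0} = (\<Union>S - {0}) \<inter> (\<Union>T - {0})"
      using S T proj_Int by blast
    then show "open (\<Union>(S \<inter> T) - {0})" using S T by (metis open_Int)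
    show "S \<inter> T \<subseteq> proj UNIV" using S by blast
  next
    fix K :: "'v set set set"
    assume K: "\<forall>S\<in>K. S \<subseteq> proj UNIV \<and> open (\<Union>S - {0})"
    have "\<Union>(\<Union>K) - {0} = (\<Union>S\<in>K. \<Union>S - {0})" by blast
    then show "open (\<Union>(\<Union>K) - {0})" using K by (metis open_UN)
    show "\<Union>K \<subseteq> proj UNIV" using K by blast
  qed
  then show ?thesis by (simp add: proj_topology_def)
qed

text \<open>The affine charts of projective space are indexed by the nonzero linear functionals
  \<open>inner a\<close>; the chart sends a line not in the kernel to its point in the hyperplane
  \<open>a \<bullet> x = 1\<close>. Being a submanifold is tested in these charts.\<close>

definition proj_submanifold :: "nat \<Rightarrow> 'v::euclidean_space set set \<Rightarrow> bool" where
  "proj_submanifold m X \<longleftrightarrow> X \<subseteq> proj UNIV \<and>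
     (\<forall>a. a \<noteq> 0 \<longrightarrow>
        smooth_submanifold {x. a \<bullet> x = 1} m {x. a \<bullet> x = 1 \<and> span {x} \<in> X})"

text \<open>\<open>Hom(l, Y/l)\<close> for \<open>l \<subseteq> Y\<close>, where elements of \<open>Y/l\<close> are cosets.\<close>

definition Hom_quot :: "'v::euclidean_space set \<Rightarrow> 'v set \<Rightarrow> ('v \<Rightarrow> 'v set) set" where
  "Hom_quot l Y =
     {\<phi> \<in> l \<rightarrow>\<^sub>E {(+) y ` l | y. y \<in> Y}.
        (\<forall>x\<in>l. \<forall>x'\<in>l. \<forall>y\<in>\<phi> x. \<forall>y'\<in>\<phi> x'. y + y' \<in> \<phi> (x + x')) \<and>
        (\<forall>c. \<forall>x\<in>l. \<forall>y\<in>\<phi> x. c *\<^sub>R y \<in> \<phi> (c *\<^sub>R x))}"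

text \<open>\<open>T\<^sub>lX\<close> as a subset of \<open>T\<^sub>l\<P>(V) = Hom(l, V/l)\<close>: a smooth curve in projective space has the form
  \<open>t \<mapsto> span {u t}\<close> locally, and its velocity at time 0 is the homomorphism that sends \<open>u 0\<close> to the
  class of \<open>u' 0\<close> modulo \<open>l\<close>.\<close>

definition proj_tangent_space ::
    "'v::euclidean_space set set \<Rightarrow> 'v set \<Rightarrow> ('v \<Rightarrow> 'v set) set" where
  "proj_tangent_space X l =
     {\<phi> \<in> Hom_quot l UNIV. \<exists>\<epsilon>>0. \<exists>u. smooth_on {-\<epsilon><..<\<epsilon>} u \<and>
        (\<forall>t\<in>{-\<epsilon><..<\<epsilon>}. u t \<noteq> 0 \<and> span {u t} \<in> X) \<and> span {u 0} = l \<and>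
        vector_derivative u (at 0) \<in> \<phi> (u 0)}"

definition Y_fibre :: "'v::euclidean_space set set \<Rightarrow> 'v set \<Rightarrow> 'v set" where
  "Y_fibre X l = (THE Y. subspace Y \<and> l \<subseteq> Y \<and> proj_tangent_space X l = Hom_quot l Y)"

section \<open>The wall\<close>

definition ker :: "('v::euclidean_space \<Rightarrow>\<^sub>L 'w::euclidean_space) \<Rightarrow> 'v set" where
  "ker f = {v. blinfun_apply f v = 0}"

definition Hom_X :: "'v::euclidean_space set set \<Rightarrow> ('v \<Rightarrow>\<^sub>L 'w::euclidean_space) set" where
  "Hom_X X = {f. X \<inter> proj (ker f) = {}}"

definition wall :: "'v::euclidean_space set set \<Rightarrow> ('v \<Rightarrow>\<^sub>L 'w::euclidean_space) set" where
  "wall X = UNIV - Hom_X X"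

definition regular_point ::
    "'v::euclidean_space set set \<Rightarrow> ('v \<Rightarrow>\<^sub>L 'w::euclidean_space) \<Rightarrow> bool" where
  "regular_point X f \<longleftrightarrow> f \<in> wall X \<and> surj (blinfun_apply f) \<and>
     (\<exists>\<xi>. X \<inter> proj (ker f) = {\<xi>} \<and> ker f \<inter> Y_fibre X \<xi> = \<xi>)"

end

theory Submission imports Defs begin

text \<open>The path is \<open>\<gamma>(t) = f0 + t (f1 - f0) + t (1 - t) g\<close> with a generic \<open>g \<in> Hom(V, W)\<close>. Its end
  points are fixed and lie off the wall, and at every time \<open>0 < t < 1\<close> the value \<open>\<gamma>(t)\<close> can be moved
  in all directions by moving \<open>g\<close>. Three things can go wrong, and a count
  of dimensions excludes each of them for generic \<open>g\<close>:

  \<^item> \<open>\<gamma>(t)\<close> fails to be surjective for some \<open>t\<close>. This needs a functional \<open>\<nu> \<noteq> 0\<close> with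
    \<open>\<nu> \<circ> \<gamma>(t) = 0\<close>, which is \<open>dim V\<close> equations for \<open>1 + m < dim V\<close> unknowns (\<open>thin_not_surjective\<close>).
  \<^item> \<open>\<gamma>(t)\<close> kills two different lines of \<open>X\<close>: \<open>2 (m + 1)\<close> equations for \<open>1 + 2 m\<close> unknowns
    (\<open>thin_double_point\<close>).
  \<^item> \<open>\<gamma>(t) x = 0\<close> for a point \<open>x\<close> of a local parametrization of \<open>X\<close> where the derivative of
    \<open>(t, x) \<mapsto> \<gamma>(t) x\<close> is singular. Source and target have the same dimension \<open>m + 1\<close> here, and
    the parameters for which this happens are critical values, so Sard's theorem applies
    (\<open>thin_degenerate\<close>).

  The three exclusions use different slices of the space of all \<open>g\<close>. They are combined by Baire's
  theorem rather than by Fubini's: each bad set is a countable union of closed sets, and a closed set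
  that meets parallel slices in null sets has empty interior (\<open>thin_of_slices\<close>).

  The remaining assertions follow from the nondegeneracy in the third item.
  Restricted to directions with \<open>dt = 0\<close> it says that \<open>\<gamma>(t)\<close> is injective on the tangent space of
  \<open>X\<close>, that is \<open>ker \<gamma>(t) \<inter> Y\<^sub>l = l\<close>. It also says that the zero is isolated, by first order
  approximation, and only the value and the velocity of the path at that time enter
  (\<open>eventually_off_wall\<close>). So \<open>\<gamma>\<close> leaves the wall at once, and by compactness there are finitely
  many crossings. A smooth curve inside the wall through the same point cannot have the same velocity,
  because it would have to leave the wall at once as well. Hence the crossing is transversal.\<close>

section \<open>Sard's theorem in equal dimensions\<close>

text \<open>A well-ordered finite index type of cardinality \<open>DIM('a)\<close>. It identifies a Euclidean space
  with a space of the form \<open>real ^ 'n\<close>, which is where \<open>baby_Sard\<close> lives.\<close>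

typedef (overloaded) 'a basis_index = "Basis :: 'a::euclidean_space set"
  using nonempty_Basis by blast

instance basis_index :: (euclidean_space) finite
proof
  have "range (Rep_basis_index :: 'a basis_index \<Rightarrow> 'a) = Basis"
    using type_definition.Rep_range[OF type_definition_basis_index] .
  then show "finite (UNIV :: 'a basis_index set)"
    by (metis Rep_basis_index_inject finite_Basis finite_imageD injI)
qed

instantiation basis_index :: (euclidean_space) wellorder
begin

definition less_eq_basis_index :: "'a basis_index \<Rightarrow> 'a basis_index \<Rightarrow> bool" where
  "less_eq_basis_index i j \<longleftrightarrow> to_nat_on UNIV i \<le> to_nat_on UNIV j"

definition less_basis_index :: "'a basis_index \<Rightarrow> 'a basis_index \<Rightarrow> bool" where
  "less_basis_index i j \<longleftrightarrow> to_nat_on UNIV i < to_nat_on UNIV j"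

instance
proof
  fix P :: "'a basis_index \<Rightarrow> bool" and a :: "'a basis_index"
  assume *: "\<And>x. (\<And>y. y < x \<Longrightarrow> P y) \<Longrightarrow> P x"
  show "P a"
    by (induction a rule: measure_induct_rule[of "to_nat_on UNIV"])
       (use * less_basis_index_def in blast)
qed (auto simp: less_eq_basis_index_def less_basis_index_def countable_finite
       inj_on_eq_iff[OF inj_on_to_nat_on])

end

lemma CARD_basis_index: "CARD('a::euclidean_space basis_index) = DIM('a)"
  by (metis type_definition.card type_definition_basis_index)

lemma Sard_euclidean:
  fixes f :: "'a::euclidean_space \<Rightarrow> 'a"
  assumes der: "\<And>x. x \<in> S \<Longrightarrow> (f has_derivative f' x) (at x within S)"
    and sing: "\<And>x. x \<in> S \<Longrightarrow> \<not> inj (f' x)"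
  shows "negligible (f ` S)"
proof -
  have dim: "DIM('a) = DIM(real ^ 'a basis_index)"
    by (simp add: CARD_basis_index)
  obtain h :: "'a \<Rightarrow> real ^ 'a basis_index" and k where lin: "linear h" "linear k"
    and hk: "\<And>x. k (h x) = x" "\<And>y. h (k y) = y"
    by (rule isomorphisms_UNIV_UNIV[OF dim]) blast
  have bl: "bounded_linear h" "bounded_linear k"
    using lin linear_conv_bounded_linear by blast+
  have "negligible ((\<lambda>y. h (f (k y))) ` (h ` S))"
  proof (rule baby_Sard)
    fix y assume y: "y \<in> h ` S"
    then have kS: "k y \<in> S" "k ` h ` S = S"
      using hk by (auto simp: image_image)
    have "(f has_derivative f' (k y)) (at (k y) within k ` h ` S)"
      using der kS by simp
    then have "((\<lambda>y. f (k y)) has_derivative (\<lambda>v. f' (k y) (k v))) (at y within h ` S)"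
      by (rule has_derivative_in_compose[OF bounded_linear_imp_has_derivative[OF bl(2)]])
    then show d: "((\<lambda>y. h (f (k y))) has_derivative (\<lambda>v. h (f' (k y) (k v)))) (at y within h ` S)"
      by (rule bounded_linear.has_derivative[OF bl(1)])
    have "\<not> inj (\<lambda>v. h (f' (k y) (k v)))"
      using sing[OF kS(1)] hk unfolding inj_def by metis
    then show "rank (matrix (\<lambda>v. h (f' (k y) (k v)))) < CARD('a basis_index)"
      using has_derivative_linear[OF d] by (simp add: less_rank_noninjective matrix_works)
  qed simp
  then have "negligible (k ` ((\<lambda>y. h (f (k y))) ` (h ` S)))"
    using dim
    by (intro negligible_differentiable_image_negligible[where f = k]
        linear_imp_differentiable_on lin(2))
       simp_all
  moreover have "k ` ((\<lambda>y. h (f (k y))) ` (h ` S)) = f ` S"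
    by (simp add: image_image hk)
  ultimately show ?thesis by simp
qed

section \<open>Thin sets\<close>

text \<open>Meagre sets, with the covering closed sets made explicit. In a space where Baire's theorem holds,
  countably many genericity conditions can be imposed at once.\<close>

definition thin :: "'a::topological_space set \<Rightarrow> bool" where
  "thin B \<longleftrightarrow> (\<exists>\<F>. countable \<F> \<and> (\<forall>F\<in>\<F>. closed F \<and> interior F = {}) \<and> B \<subseteq> \<Union>\<F>)"

lemma thin_closed: "closed F \<Longrightarrow> interior F = {} \<Longrightarrow> thin F"
  unfolding thin_def by (rule exI[of _ "{F}"]) simp

lemma thin_subset: "thin B \<Longrightarrow> A \<subseteq> B \<Longrightarrow> thin A"
  unfolding thin_def by (meson subset_trans)

lemma thin_UN:
  assumes "countable I" and "\<And>i. i \<in> I \<Longrightarrow> thin (B i)"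
  shows "thin (\<Union>i\<in>I. B i)"
proof -
  have "\<forall>i\<in>I. \<exists>\<F>. countable \<F> \<and> (\<forall>F\<in>\<F>. closed F \<and> interior F = {}) \<and> B i \<subseteq> \<Union>\<F>"
    using assms(2) unfolding thin_def by simp
  from bchoice[OF this] obtain \<F> where \<F>:
    "\<forall>i\<in>I. countable (\<F> i) \<and> (\<forall>F\<in>\<F> i. closed F \<and> interior F = {}) \<and> B i \<subseteq> \<Union>(\<F> i)" ..
  have "countable (\<Union>i\<in>I. \<F> i)" using assms(1) \<F> by simp
  moreover have "\<forall>F\<in>(\<Union>i\<in>I. \<F> i). closed F \<and> interior F = {}" using \<F> by simp
  moreover have "(\<Union>i\<in>I. B i) \<subseteq> \<Union>(\<Union>i\<in>I. \<F> i)"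
  proof
    fix x assume "x \<in> (\<Union>i\<in>I. B i)"
    then obtain i where "i \<in> I" "x \<in> B i" by auto
    moreover from this have "B i \<subseteq> \<Union>(\<F> i)" using \<F> by simp
    ultimately have "i \<in> I" "x \<in> \<Union>(\<F> i)" by auto
    then show "x \<in> \<Union>(\<Union>i\<in>I. \<F> i)" by auto
  qed
  ultimately show ?thesis unfolding thin_def by (rule_tac x = "\<Union>i\<in>I. \<F> i" in exI) (intro conjI)
qed

lemma thin_Un: "thin A \<Longrightarrow> thin B \<Longrightarrow> thin (A \<union> B)"
  using thin_UN[of "{True, False}" "\<lambda>i. if i then A else B"] by (simp add: Un_commute)

lemma not_thin_UNIV: "\<not> thin (UNIV :: 'a::{real_normed_vector,heine_borel} set)"
proof
  assume "thin (UNIV :: 'a set)"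
  then obtain \<F> :: "'a set set" where F: "countable \<F>" "\<And>F. F \<in> \<F> \<Longrightarrow> closed F \<and> interior F = {}"
    "UNIV \<subseteq> \<Union>\<F>" unfolding thin_def by blast
  have "(UNIV :: 'a set) \<subseteq> closure (\<Inter>(uminus ` \<F>))"
    by (rule Baire) (use F in \<open>auto simp: closure_complement\<close>)
  moreover have "\<Inter>(uminus ` \<F>) = {}" using F(3) by blast
  ultimately show False by simp
qed

text \<open>A bad parameter has a witness in the compact set, so limits of bad parameters are bad.\<close>

lemma compact_projection_closed:
  fixes K :: "'p::{heine_borel,real_normed_vector} set"
    and G :: "'p \<times> 'g::{heine_borel,real_normed_vector} \<Rightarrow> 'q::real_normed_vector"
  assumes K: "compact K" and cont: "continuous_on (K \<times> UNIV) G"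
  shows "closed {g. \<exists>c\<in>K. G (c, g) = 0}"
proof -
  have *: "closed ((K \<times> UNIV) \<inter> G -` {0})"
    using K by (intro continuous_closed_preimage cont) (auto simp: closed_Times compact_imp_closed)
  have "closed (snd ` ((K \<times> UNIV) \<inter> G -` {0}))"
    unfolding closed_sequential_limits
  proof (intro allI impI)
    fix x l assume "(\<forall>n. x n \<in> snd ` (K \<times> UNIV \<inter> G -` {0})) \<and> x \<longlonglongrightarrow> l"
    then have x: "\<forall>n. \<exists>c\<in>K. (c, x n) \<in> K \<times> UNIV \<inter> G -` {0}" "x \<longlonglongrightarrow> l" by fastforce+
    then obtain c where c: "\<And>n. c n \<in> K" "\<And>n. (c n, x n) \<in> K \<times> UNIV \<inter> G -` {0}" by metis
    obtain c0 r where r: "c0 \<in> K" "strict_mono r" "(c \<circ> r) \<longlonglongrightarrow> c0"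
      using seq_compactE[of K c] K c(1) compact_imp_seq_compact by blast
    have "(\<lambda>n. ((c \<circ> r) n, (x \<circ> r) n)) \<longlonglongrightarrow> (c0, l)"
      by (intro tendsto_Pair r LIMSEQ_subseq_LIMSEQ x)
    then have "(c0, l) \<in> K \<times> UNIV \<inter> G -` {0}"
      by (rule closed_sequentially[OF *, rotated]) (use c(2) in auto)
    then show "l \<in> snd ` (K \<times> UNIV \<inter> G -` {0})" by force
  qed
  moreover have "snd ` ((K \<times> UNIV) \<inter> G -` {0}) = {g. \<exists>c\<in>K. G (c, g) = 0}" by force
  ultimately show ?thesis by simp
qed

text \<open>The criterion behind all genericity arguments below. Exhausting \<open>C\<close> by compact sets writes the
  bad set as a countable union of closed sets. An interior point of one of them would give an open
  subset of a slice, which is not negligible. Only one linear family of perturbations is needed, and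
  different bad sets may use different families.\<close>

lemma thin_of_slices:
  fixes F :: "'p::euclidean_space \<Rightarrow> 'g::{real_normed_vector,heine_borel} \<Rightarrow> 'q::real_normed_vector"
    and \<iota> :: "'s::euclidean_space \<Rightarrow> 'g"
  assumes "open C" and cont: "continuous_on (C \<times> UNIV) (\<lambda>(c, g). F c g)"
    and \<iota>: "bounded_linear \<iota>"
    and slice: "\<And>g. negligible {s. \<exists>c\<in>C. F c (g + \<iota> s) = 0}"
  shows "thin {g. \<exists>c\<in>C. F c g = 0}"
proof -
  obtain K :: "nat \<Rightarrow> 'p set" where K: "\<And>n. compact (K n)" "\<And>n. K n \<subseteq> C" "\<Union>(range K) = C"
    by (rule open_Union_compact_subsets[OF \<open>open C\<close>]) (rule that; assumption)
  define B where "B n = {g. \<exists>c\<in>K n. F c g = 0}" for n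
  have closed: "closed (B n)" for n
  proof -
    have "continuous_on (K n \<times> UNIV) (\<lambda>(c, g). F c g)"
      by (rule continuous_on_subset[OF cont]) (use K(2)[of n] in blast)
    from compact_projection_closed[OF K(1) this] show ?thesis
      unfolding B_def by simp
  qed
  have "interior (B n) = {}" for n
  proof (rule ccontr)
    assume "interior (B n) \<noteq> {}"
    then obtain g where g: "g \<in> interior (B n)" by blast
    interpret bounded_linear \<iota> by fact
    let ?U = "(\<lambda>s. g + \<iota> s) -` interior (B n)"
    have "open ?U"
      by (intro open_vimage continuous_on_add continuous_on_const linear_continuous_on \<iota> open_interior)
    moreover have "0 \<in> ?U" using g by (simp add: zero)
    moreover have "?U \<subseteq> {s. \<exists>c\<in>C. F c (g + \<iota> s) = 0}"
      using interior_subset[of "B n"] K(2)[of n] unfolding B_def by auto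
    ultimately show False
      using negligible_subset[OF slice[of g], of ?U] open_not_negligible[of ?U] by blast
  qed
  then have "thin (\<Union>n\<in>UNIV. B n)"
    using closed by (intro thin_UN thin_closed) auto
  moreover have "(\<Union>n\<in>UNIV. B n) = {g. \<exists>c\<in>C. F c g = 0}"
    unfolding B_def K(3)[symmetric] by blast
  ultimately show ?thesis by simp
qed

section \<open>Smooth maps\<close>

lemma Ck_on_cong:
  assumes "open U" and "\<And>x. x \<in> U \<Longrightarrow> f x = g x"
  shows "Ck_on k f U \<longleftrightarrow> Ck_on k g U"
  using assms(2)
proof (induction k arbitrary: f g)
  case 0
  then show ?case by (simp cong: continuous_on_cong)
next
  case (Suc k)
  have D: "(f has_derivative D) (at x) \<longleftrightarrow> (g has_derivative D) (at x)" if "x \<in> U" for x D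
    using has_derivative_transform_within_open[OF _ \<open>open U\<close> that] Suc.prems by metis
  then have "frechet_derivative f (at x) = frechet_derivative g (at x)" if "x \<in> U" for x
    using that by (simp add: frechet_derivative_def)
  then have "Ck_on k (\<lambda>x. frechet_derivative f (at x) v) U \<longleftrightarrow>
      Ck_on k (\<lambda>x. frechet_derivative g (at x) v) U" for v
    by (intro Suc.IH) simp
  moreover have "f differentiable (at x) \<longleftrightarrow> g differentiable (at x)" if "x \<in> U" for x
    using D[OF that] by (simp add: differentiable_def)
  ultimately show ?case by simp
qed

text \<open>Smoothness of the curves that realise the tangent vectors of a parametrized submanifold.\<close>

lemma Ck_on_along_line:
  fixes f :: "'a::euclidean_space \<Rightarrow> 'b::real_normed_vector"
  assumes "open U" and "Ck_on k f U"
  shows "Ck_on k (\<lambda>t::real. f (q + t *\<^sub>R d)) {t. q + t *\<^sub>R d \<in> U}"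
  using assms(2)
proof (induction k arbitrary: f)
  case 0
  show ?case unfolding Ck_on.simps(1)
    by (rule continuous_on_compose2[of U f]) (use 0 in \<open>auto intro!: continuous_intros\<close>)
next
  case (Suc k)
  let ?I = "{t. q + t *\<^sub>R d \<in> U}"
  have "open ((\<lambda>t. q + t *\<^sub>R d) -` U)"
    by (intro open_vimage \<open>open U\<close> continuous_intros)
  then have I: "open ?I" by (simp add: vimage_def)
  have D: "((\<lambda>t. f (q + t *\<^sub>R d)) has_derivative
      (\<lambda>s. frechet_derivative f (at (q + t *\<^sub>R d)) (s *\<^sub>R d))) (at t)" if "t \<in> ?I" for t
  proof -
    have "(f has_derivative frechet_derivative f (at (q + t *\<^sub>R d))) (at (q + t *\<^sub>R d))"
      using Suc.prems that by (simp add: frechet_derivative_works)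
    moreover have "((\<lambda>t. q + t *\<^sub>R d) has_derivative (\<lambda>s. s *\<^sub>R d)) (at t)"
      by (auto intro!: derivative_eq_intros)
    ultimately show ?thesis
      using has_derivative_compose by blast
  qed
  have "Ck_on k (\<lambda>t. frechet_derivative (\<lambda>t. f (q + t *\<^sub>R d)) (at t) v) ?I" for v
  proof -
    have "Ck_on k (\<lambda>t. (\<lambda>x. frechet_derivative f (at x) (v *\<^sub>R d)) (q + t *\<^sub>R d)) ?I"
      using Suc.prems by (intro Suc.IH) simp
    moreover have "frechet_derivative (\<lambda>t. f (q + t *\<^sub>R d)) (at t) v =
        frechet_derivative f (at (q + t *\<^sub>R d)) (v *\<^sub>R d)" if "t \<in> ?I" for t
      using frechet_derivative_at[OF D[OF that]] by metis
    ultimately show ?thesis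
      using Ck_on_cong[OF I, of "\<lambda>t. frechet_derivative (\<lambda>t. f (q + t *\<^sub>R d)) (at t) v"] by simp
  qed
  then show ?case using D by (auto simp: differentiable_def)
qed

text \<open>Quadratic polynomials are closed under differentiation, so the coefficients have to be arbitrary for
  the induction. The perturbed segments below have this form.\<close>

lemma Ck_on_quadratic: "Ck_on k (\<lambda>t::real. A + t *\<^sub>R B + t\<^sup>2 *\<^sub>R C) UNIV"
proof (induction k arbitrary: A B C)
  case 0
  show ?case by (auto intro!: continuous_intros)
next
  case (Suc k)
  have D: "((\<lambda>t. A + t *\<^sub>R B + t\<^sup>2 *\<^sub>R C) has_derivative (\<lambda>s. s *\<^sub>R B + (2 * t * s) *\<^sub>R C)) (at t)"
    for t
    by (auto intro!: derivative_eq_intros simp: algebra_simps)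
  have "(\<lambda>t. frechet_derivative (\<lambda>t. A + t *\<^sub>R B + t\<^sup>2 *\<^sub>R C) (at t) v) =
      (\<lambda>t. v *\<^sub>R B + t *\<^sub>R ((2 * v) *\<^sub>R C) + t\<^sup>2 *\<^sub>R 0)" for v
    by (simp only: frechet_derivative_at[OF D, symmetric]) (simp add: algebra_simps)
  then have "Ck_on k (\<lambda>t. frechet_derivative (\<lambda>t. A + t *\<^sub>R B + t\<^sup>2 *\<^sub>R C) (at t) v) UNIV" for v
    by (simp only: Suc.IH)
  then show ?case using D by (auto simp: differentiable_def)
qed

lemma smooth_onD:
  assumes "smooth_on S f" and "x \<in> S"
  obtains V g where "open V" "x \<in> V" "\<And>k. Ck_on k g V" "\<And>y. y \<in> S \<Longrightarrow> y \<in> V \<Longrightarrow> g y = f y"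
  using assms unfolding smooth_on_def by (metis IntI)

lemma smooth_imp_differentiable:
  assumes "\<And>k. Ck_on k g V" and "x \<in> V"
  shows "g differentiable (at x)"
  using assms(1)[of 1] assms(2) by simp

lemma smooth_imp_has_derivative:
  assumes "\<And>k. Ck_on k g V" and "x \<in> V"
  shows "(g has_derivative frechet_derivative g (at x)) (at x)"
  using smooth_imp_differentiable[OF assms] by (simp add: frechet_derivative_works)

section \<open>Charts of projective submanifolds\<close>

text \<open>A local parametrization \<open>P\<close> of the part of \<open>X\<close> in the affine chart \<open>a \<bullet> x = 1\<close>. The submanifold has
  dimension one less than the Euclidean space that carries the coordinates, and \<open>P\<close> is constant
  in the direction of the unit vector \<open>e\<close>. The free coordinate \<open>u \<bullet> e\<close> serves as time, so
  that a point \<open>u\<close> encodes a pair of a time and a line of \<open>X\<close>, and maps such as \<open>u \<mapsto> \<gamma>(u \<bullet> e) (P u)\<close>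
  go between spaces of equal dimension. The map \<open>R\<close> is a differentiable inverse that is defined on an
  open set of the ambient space; it selects the coordinates with \<open>u \<bullet> e = 0\<close>.\<close>

locale manifold_chart =
  fixes X :: "'v::euclidean_space set set" and a :: 'v and e :: "'w::euclidean_space"
    and U :: "'w set" and P :: "'w \<Rightarrow> 'v" and P' :: "'w \<Rightarrow> 'w \<Rightarrow>\<^sub>L 'v"
    and N :: "'v set" and R :: "'v \<Rightarrow> 'w"
  assumes norm_e: "norm e = 1"
    and open_U: "open U" and open_N: "open N"
    and P_deriv: "u \<in> U \<Longrightarrow> (P has_derivative blinfun_apply (P' u)) (at u)"
    and P'_cont: "continuous_on U P'"
    and P_curve: "u \<in> U \<Longrightarrow> \<exists>\<epsilon>>0. smooth_on {-\<epsilon><..<\<epsilon>} (\<lambda>t. P (u + t *\<^sub>R h))"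
    and P_N: "u \<in> U \<Longrightarrow> P u \<in> N" and P_a: "u \<in> U \<Longrightarrow> a \<bullet> P u = 1"
    and P_X: "u \<in> U \<Longrightarrow> span {P u} \<in> X"
    and U_cyl: "u \<in> U \<Longrightarrow> u + s *\<^sub>R e \<in> U" and P_cyl: "u \<in> U \<Longrightarrow> P (u + s *\<^sub>R e) = P u"
    and R_diff: "x \<in> N \<Longrightarrow> R differentiable (at x)"
    and R_P: "u \<in> U \<Longrightarrow> R (P u) = u - (u \<bullet> e) *\<^sub>R e"
    and R_U: "x \<in> N \<Longrightarrow> a \<bullet> x = 1 \<Longrightarrow> span {x} \<in> X \<Longrightarrow> R x \<in> U"
    and P_R: "x \<in> N \<Longrightarrow> a \<bullet> x = 1 \<Longrightarrow> span {x} \<in> X \<Longrightarrow> P (R x) = x"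

text \<open>A straightening diffeomorphism and its inverse have smooth extensions \<open>g1\<close> and \<open>g2\<close> to open sets of
  the ambient space. Composing them with a linear isomorphism between the hyperplane
  orthogonal to \<open>e\<close> and the direction of the straightened submanifold gives \<open>R\<close> and \<open>P\<close>.\<close>

lemma manifold_chart_exists:
  fixes X :: "'v::euclidean_space set set" and e :: "'w::euclidean_space"
  assumes X: "proj_submanifold m X" and dim: "DIM('w) = m + 1" and e: "norm e = 1"
    and p: "a \<bullet> p = 1" "span {p} \<in> X"
  shows "\<exists>U P P' N R. manifold_chart X a e U P P' N R \<and> p \<in> N"
proof -
  define A where "A = {x. a \<bullet> x = 1}"
  define M where "M = {x. a \<bullet> x = 1 \<and> span {x} \<in> X}"
  have "a \<noteq> 0" using p by auto
  then have "smooth_submanifold A m M"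
    using X unfolding proj_submanifold_def A_def M_def by blast
  moreover have "p \<in> M" using p by (simp add: M_def)
  ultimately obtain UA QA \<phi> \<psi> E where
    UA: "openin (top_of_set A) UA" "p \<in> UA" and QA: "openin (top_of_set A) QA"
    and hom: "homeomorphism UA QA \<phi> \<psi>" and sm: "smooth_on UA \<phi>" "smooth_on QA \<psi>"
    and E: "affine E" "E \<subseteq> A" "aff_dim E = int m" and im: "\<phi> ` (M \<inter> UA) = E \<inter> QA"
    unfolding smooth_submanifold_def by metis
  obtain U0 where U0: "open U0" "UA = A \<inter> U0" using UA(1) by (auto simp: openin_open)
  obtain Q0 where Q0: "open Q0" "QA = A \<inter> Q0" using QA(1) by (auto simp: openin_open)
  have \<psi>\<phi>: "\<psi> (\<phi> x) = x" "\<phi> x \<in> QA" if "x \<in> UA" for x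
    using hom that unfolding homeomorphism_def by auto
  have \<phi>\<psi>: "\<phi> (\<psi> y) = y" "\<psi> y \<in> UA" if "y \<in> QA" for y
    using hom that unfolding homeomorphism_def by auto
  obtain U1 g1 where g1: "open U1" "p \<in> U1" "\<And>k. Ck_on k g1 U1"
    "\<And>y. y \<in> UA \<Longrightarrow> y \<in> U1 \<Longrightarrow> g1 y = \<phi> y"
    by (rule smooth_onD[OF sm(1) UA(2)]) (rule that; assumption)
  define q0 where "q0 = \<phi> p"
  have q0: "q0 \<in> QA" "q0 \<in> E" using \<psi>\<phi>[OF UA(2)] im UA(2) \<open>p \<in> M\<close> by (auto simp: q0_def)
  obtain U2 g2 where g2: "open U2" "q0 \<in> U2" "\<And>k. Ck_on k g2 U2"
    "\<And>y. y \<in> QA \<Longrightarrow> y \<in> U2 \<Longrightarrow> g2 y = \<psi> y"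
    by (rule smooth_onD[OF sm(2) q0(1)]) (rule that; assumption)
  define T where "T = (\<lambda>x. x - q0) ` E"
  have subT: "subspace T"
    using affine_diffs_subspace_subtract[OF E(1) q0(2)] unfolding T_def .
  have T_E: "q0 + v \<in> E \<longleftrightarrow> v \<in> T" for v
    unfolding T_def by (auto simp: image_iff intro!: bexI[of _ "q0 + v"])
  have "aff_dim T = int m"
    using E(3) aff_dim_translation_eq_subtract[of q0 E] unfolding T_def by simp
  then have dimT: "dim T = m" using aff_dim_subspace[OF subT] by simp
  define H where "H = {u. e \<bullet> u = 0}"
  have "e \<noteq> 0" using e by auto
  have subH: "subspace H" unfolding H_def by (rule subspace_hyperplane)
  have dimH: "dim H = dim T"
    using dim_hyperplane[OF \<open>e \<noteq> 0\<close>] dim dimT by (simp add: H_def)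
  obtain L0 K0 where L0: "linear L0" "linear K0" "L0 ` H = T" "K0 ` T = H"
    "\<And>x. x \<in> H \<Longrightarrow> K0 (L0 x) = x" "\<And>x. x \<in> T \<Longrightarrow> L0 (K0 x) = x"
    by (rule isometries_subspaces[OF subH subT dimH]) (rule that; assumption)
  define \<pi> where "\<pi> u = u - (u \<bullet> e) *\<^sub>R e" for u
  have \<pi>H: "\<pi> u \<in> H" for u
    using e unfolding \<pi>_def H_def by (simp add: inner_diff_right inner_commute norm_eq_1)
  have \<pi>id: "\<pi> u = u" if "u \<in> H" for u
    using that unfolding \<pi>_def H_def by (simp add: inner_commute)
  have \<pi>lin: "bounded_linear \<pi>"
    unfolding \<pi>_def
    by (intro bounded_linear_sub bounded_linear_ident bounded_linear_compose[OF bounded_linear_scaleR_left]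
      bounded_linear_inner_left)
  have \<pi>cyl: "\<pi> (u + s *\<^sub>R e) = \<pi> u" for u s
    using e unfolding \<pi>_def by (simp add: algebra_simps norm_eq_1)
  \<comment> \<open>projecting along \<open>e\<close> first makes \<open>P\<close> invariant in that direction\<close>
  define L where "L u = L0 (\<pi> u)" for u
  have Llin: "bounded_linear L"
    unfolding L_def using L0(1) \<pi>lin bounded_linear_compose linear_conv_bounded_linear by blast
  have Kbl: "bounded_linear K0" using L0(2) linear_conv_bounded_linear by blast
  have LT: "L u \<in> T" for u using \<pi>H L0(3) unfolding L_def by blast
  have K0L: "K0 (L u) = \<pi> u" for u using L0(5)[OF \<pi>H] unfolding L_def by simp
  have LK0: "L (K0 v) = v" if "v \<in> T" for v
    using that L0(4,6) \<pi>id unfolding L_def by (metis image_eqI)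
  define P where "P u = g2 (q0 + L u)" for u
  define R where "R x = K0 (g1 x - q0)" for x
  define U where "U = {u. q0 + L u \<in> {q \<in> U2 \<inter> Q0. g2 q \<in> U1 \<inter> U0}}"
  define N where "N = {x \<in> U1 \<inter> U0. g1 x \<in> U2 \<inter> Q0}"
  have cont: "continuous_on U1 g1" "continuous_on U2 g2" using g1(3)[of 0] g2(3)[of 0] by auto
  have openN: "open N"
  proof -
    have "open (U1 \<inter> g1 -` (U2 \<inter> Q0))"
      by (intro continuous_open_preimage cont g1 g2 Q0 open_Int)
    moreover have "N = U0 \<inter> (U1 \<inter> g1 -` (U2 \<inter> Q0))" unfolding N_def by blast
    ultimately show ?thesis using U0(1) by (simp add: open_Int)
  qed
  have openU: "open U"
  proof -
    have "open (U2 \<inter> g2 -` (U1 \<inter> U0))"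
      by (intro continuous_open_preimage cont g1 g2 U0 open_Int)
    then have "open (Q0 \<inter> (U2 \<inter> g2 -` (U1 \<inter> U0)))" using Q0(1) by (simp add: open_Int)
    moreover have "{q \<in> U2 \<inter> Q0. g2 q \<in> U1 \<inter> U0} = Q0 \<inter> (U2 \<inter> g2 -` (U1 \<inter> U0))" by blast
    ultimately have "open {q \<in> U2 \<inter> Q0. g2 q \<in> U1 \<inter> U0}" by simp
    then have "open ((\<lambda>u. q0 + L u) -` {q \<in> U2 \<inter> Q0. g2 q \<in> U1 \<inter> U0})"
      by (intro open_vimage continuous_on_add continuous_on_const linear_continuous_on Llin)
    then show ?thesis unfolding U_def vimage_def .
  qed
  \<comment> \<open>on \<open>U\<close> and \<open>N\<close> the extensions may be replaced by the diffeomorphism itself\<close>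
  have key: "P u = \<psi> (q0 + L u) \<and> P u \<in> M \<and> P u \<in> UA \<and> \<phi> (P u) = q0 + L u \<and> P u \<in> U1 \<and> q0 + L u \<in> U2 \<inter> Q0"
    if "u \<in> U" for u
  proof -
    have qE: "q0 + L u \<in> E" using T_E LT by blast
    have q: "q0 + L u \<in> QA" "q0 + L u \<in> U2" using that qE E(2) Q0(2) unfolding U_def by auto
    have Pu: "P u = \<psi> (q0 + L u)" using g2(4)[OF q] unfolding P_def .
    obtain x where x: "x \<in> M \<inter> UA" "\<phi> x = q0 + L u" using im qE q(1) by (metis IntI imageE)
    then have "P u = x" using Pu \<psi>\<phi>(1)[of x] by simp
    then show ?thesis using x Pu that unfolding U_def P_def by auto
  qed
  have inverse_at: "R x \<in> U \<and> P (R x) = x" if x: "x \<in> N" "x \<in> M" for x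
  proof -
    have xU: "x \<in> UA" "x \<in> U1" using x U0(2) unfolding N_def M_def A_def by auto
    have "\<phi> x \<in> E" using im x(2) xU(1) by blast
    then have "\<phi> x - q0 \<in> T" unfolding T_def by blast
    then have L: "q0 + L (R x) = \<phi> x"
      unfolding R_def g1(4)[OF xU] using LK0 by simp
    have in2: "\<phi> x \<in> U2 \<inter> Q0" using x(1) g1(4)[OF xU] unfolding N_def by simp
    have "g2 (\<phi> x) = x" using g2(4)[of "\<phi> x"] in2 \<psi>\<phi>[OF xU(1)] by simp
    then show ?thesis using L in2 x(1) unfolding U_def P_def N_def by auto
  qed
  define P' where "P' u = Blinfun (\<lambda>h. frechet_derivative g2 (at (q0 + L u)) (L h))" for u
  have P'_app: "blinfun_apply (P' u) = (\<lambda>h. frechet_derivative g2 (at (q0 + L u)) (L h))"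
    if "u \<in> U" for u
  proof -
    have "q0 + L u \<in> U2" using that unfolding U_def by simp
    then have "bounded_linear (frechet_derivative g2 (at (q0 + L u)))"
      using smooth_imp_has_derivative[OF g2(3)] has_derivative_bounded_linear by blast
    from bounded_linear_compose[OF this Llin] show ?thesis
      unfolding P'_def by (simp add: bounded_linear_Blinfun_apply)
  qed
  have "manifold_chart X a e U P P' N R"
  proof
    show "norm e = 1" "open U" "open N" by fact+
    fix u assume u: "u \<in> U"
    then have u2: "q0 + L u \<in> U2" unfolding U_def by simp
    have "((\<lambda>u. q0 + L u) has_derivative L) (at u)"
      using has_derivative_add[OF has_derivative_const[of q0] bounded_linear_imp_has_derivative[OF Llin]]
      by simp
    from has_derivative_compose[OF this smooth_imp_has_derivative[OF g2(3) u2]]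
    show "(P has_derivative blinfun_apply (P' u)) (at u)"
      unfolding P'_app[OF u] P_def .
    show "P u \<in> N" using key[OF u] U0(2) g1(4)[of "P u"] unfolding N_def by auto
    show "a \<bullet> P u = 1" "span {P u} \<in> X" using key[OF u] unfolding M_def by auto
    have Lcyl: "L (u + s *\<^sub>R e) = L u" for s :: real unfolding L_def \<pi>cyl ..
    show "u + s *\<^sub>R e \<in> U" for s :: real using u unfolding U_def by (simp add: Lcyl)
    show "P (u + s *\<^sub>R e) = P u" for s :: real unfolding P_def Lcyl ..
    show "R (P u) = u - (u \<bullet> e) *\<^sub>R e"
    proof -
      have "P u \<in> UA" "P u \<in> U1" "\<phi> (P u) = q0 + L u" using key[OF u] by blast+
      then have "g1 (P u) = q0 + L u" using g1(4) by metis
      then show ?thesis using K0L[of u] unfolding R_def \<pi>_def by simp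
    qed
    show "\<exists>\<epsilon>>0. smooth_on {-\<epsilon><..<\<epsilon>} (\<lambda>t. P (u + t *\<^sub>R h))" for h
    proof -
      let ?I = "{t. (q0 + L u) + t *\<^sub>R L h \<in> U2}"
      have "open ((\<lambda>t. (q0 + L u) + t *\<^sub>R L h) -` U2)"
        by (intro open_vimage g2(1) continuous_intros)
      then have I: "open ?I" by (simp add: vimage_def)
      moreover have "0 \<in> ?I" using u2 by simp
      ultimately obtain \<epsilon> where \<epsilon>: "\<epsilon> > 0" "ball 0 \<epsilon> \<subseteq> ?I" using open_contains_ball by blast
      have eq: "P (u + t *\<^sub>R h) = g2 ((q0 + L u) + t *\<^sub>R L h)" for t
        using Llin unfolding P_def by (simp add: linear_simps add.assoc)
      have "Ck_on k (\<lambda>t. P (u + t *\<^sub>R h)) ?I" for k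
        unfolding eq by (rule Ck_on_along_line[OF g2(1,3)])
      then have "smooth_on {-\<epsilon><..<\<epsilon>} (\<lambda>t. P (u + t *\<^sub>R h))"
        unfolding smooth_on_def using I \<epsilon>
        by (intro ballI exI[of _ ?I] exI[of _ "\<lambda>t. P (u + t *\<^sub>R h)"])
           (auto simp: subset_iff dist_real_def)
      then show ?thesis using \<epsilon> by blast
    qed
  next
    fix x assume x: "x \<in> N"
    then have "g1 differentiable (at x)" using smooth_imp_differentiable[OF g1(3)] unfolding N_def by simp
    then obtain D where D: "(g1 has_derivative D) (at x)" unfolding differentiable_def ..
    have "((\<lambda>x. g1 x - q0) has_derivative D) (at x)"
      using has_derivative_diff[OF D has_derivative_const[of q0]] by simp
    from bounded_linear.has_derivative[OF Kbl this]
    show "R differentiable (at x)" unfolding R_def differentiable_def by blast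
    assume "a \<bullet> x = 1" "span {x} \<in> X"
    then show "R x \<in> U" "P (R x) = x" using inverse_at[OF x] unfolding M_def by auto
  next
    show "continuous_on U P'"
    proof (rule continuous_on_blinfun_componentwise)
      fix i :: 'w
      have "continuous_on U2 (\<lambda>q. frechet_derivative g2 (at q) (L i))"
        using g2(3)[of 1] by simp
      then have "continuous_on U (\<lambda>u. frechet_derivative g2 (at (q0 + L u)) (L i))"
        by (rule continuous_on_compose2[OF _ continuous_on_add[OF continuous_on_const
              linear_continuous_on[OF Llin]]]) (auto simp: U_def)
      then show "continuous_on U (\<lambda>u. blinfun_apply (P' u) i)"
        by (rule continuous_on_eq) (simp add: P'_app)
    qed
  qed
  moreover have "p \<in> N" using UA U0(2) g1(2,4) g2(2) q0(1) Q0(2) unfolding N_def q0_def by auto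
  ultimately show ?thesis by blast
qed

section \<open>The tangent fibre\<close>

lemma smooth_on_subset:
  assumes "smooth_on S f" and "T \<subseteq> S"
  shows "smooth_on T f"
  unfolding smooth_on_def
proof
  fix x assume "x \<in> T"
  then obtain V g where "open V" "x \<in> V" "\<And>k. Ck_on k g V" "\<And>y. y \<in> S \<Longrightarrow> y \<in> V \<Longrightarrow> g y = f y"
    using smooth_onD[OF assms(1), of x] assms(2) by blast
  then show "\<exists>V g. open V \<and> x \<in> V \<and> (\<forall>k. Ck_on k g V) \<and> (\<forall>y\<in>T \<inter> V. g y = f y)"
    using assms(2) by (intro exI[of _ V] exI[of _ g]) auto
qed

lemma smooth_on_interval_has_vector_derivative:
  fixes c :: "real \<Rightarrow> 'b::real_normed_vector"
  assumes "smooth_on {-\<epsilon><..<\<epsilon>} c" and "\<epsilon> > 0"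
  shows "(c has_vector_derivative vector_derivative c (at 0)) (at 0)"
proof -
  have "0 \<in> {-\<epsilon><..<\<epsilon>}" using assms(2) by simp
  from smooth_onD[OF assms(1) this] obtain V g where g: "open V" "0 \<in> V" "\<And>k. Ck_on k g V"
    "\<And>y. y \<in> {-\<epsilon><..<\<epsilon>} \<Longrightarrow> y \<in> V \<Longrightarrow> g y = c y" by metis
  have "(c has_derivative frechet_derivative g (at 0)) (at 0)"
    by (rule has_derivative_transform_within_open[OF smooth_imp_has_derivative[OF g(3,2)],
          of "{-\<epsilon><..<\<epsilon>} \<inter> V"]) (use g assms(2) in auto)
  then show ?thesis
    using vector_derivative_works differentiableI by blast
qed

lemma coset_eq_iff_mem:
  assumes "subspace l" and "z \<in> (+) y ` l"
  shows "(+) y ` l = (+) z ` l"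
proof -
  obtain w where w: "z = y + w" "w \<in> l" using assms(2) by blast
  have "y + x \<in> (+) z ` l" "z + x \<in> (+) y ` l" if "x \<in> l" for x
    using w(2) that assms(1)
    by (auto simp: w(1) subspace_diff subspace_add image_iff add.assoc intro: bexI[of _ "x - w"])
  then show ?thesis by blast
qed

lemma Hom_quotD:
  assumes "\<phi> \<in> Hom_quot l Y" and "x \<in> l"
  shows Hom_quot_coset: "\<exists>y\<in>Y. \<phi> x = (+) y ` l"
    and Hom_quot_scale: "y \<in> \<phi> x \<Longrightarrow> c *\<^sub>R y \<in> \<phi> (c *\<^sub>R x)"
proof -
  have "\<phi> \<in> l \<rightarrow>\<^sub>E {(+) y ` l | y. y \<in> Y}" "\<forall>c. \<forall>x\<in>l. \<forall>y\<in>\<phi> x. c *\<^sub>R y \<in> \<phi> (c *\<^sub>R x)"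
    using assms(1) unfolding Hom_quot_def by blast+
  then show "\<exists>y\<in>Y. \<phi> x = (+) y ` l" and "y \<in> \<phi> x \<Longrightarrow> c *\<^sub>R y \<in> \<phi> (c *\<^sub>R x)"
    using assms(2) PiE_mem[of \<phi> l "\<lambda>_. {(+) y ` l | y. y \<in> Y}" x] by auto
qed

text \<open>An element of \<open>Hom(l, Y/l)\<close> is determined by its value at a generator of \<open>l\<close>, which is a coset of \<open>l\<close>.
  Hence \<open>Hom(l, Y/l)\<close> is cut out of \<open>Hom(l, V/l)\<close> by one inclusion.\<close>

lemma Hom_quot_iff:
  assumes "p \<noteq> 0" and "subspace Y" and "span {p} \<subseteq> Y"
  shows "\<phi> \<in> Hom_quot (span {p}) Y \<longleftrightarrow> \<phi> \<in> Hom_quot (span {p}) UNIV \<and> \<phi> p \<subseteq> Y"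
proof
  assume \<phi>: "\<phi> \<in> Hom_quot (span {p}) Y"
  then obtain y where "y \<in> Y" "\<phi> p = (+) y ` span {p}"
    using Hom_quot_coset[of \<phi> "span {p}" Y p] by (auto simp: span_base)
  then have "\<phi> p \<subseteq> Y" using assms(2,3) by (auto intro!: subspace_add)
  moreover have "\<phi> \<in> Hom_quot (span {p}) UNIV"
    using \<phi> unfolding Hom_quot_def PiE_def Pi_def by blast
  ultimately show "\<phi> \<in> Hom_quot (span {p}) UNIV \<and> \<phi> p \<subseteq> Y" by blast
next
  assume *: "\<phi> \<in> Hom_quot (span {p}) UNIV \<and> \<phi> p \<subseteq> Y"
  have "\<phi> x \<in> {(+) y ` span {p} | y. y \<in> Y}" if x: "x \<in> span {p}" for x
  proof -
    obtain c where c: "x = c *\<^sub>R p" using x by (auto simp: span_singleton)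
    have \<phi>: "\<phi> \<in> Hom_quot (span {p}) UNIV" using * by blast
    have p: "p \<in> span {p}" by (simp add: span_base)
    obtain y where y: "\<phi> p = (+) y ` span {p}" using Hom_quot_coset[OF \<phi> p] by blast
    then have "y \<in> \<phi> p" using span_zero[of "{p}"] by force
    then have cy: "c *\<^sub>R y \<in> Y" "c *\<^sub>R y \<in> \<phi> x"
      using * Hom_quot_scale[OF \<phi> p] assms(2) c by (auto simp: subspace_scale)
    obtain z where "\<phi> x = (+) z ` span {p}" using Hom_quot_coset[OF \<phi> x] by blast
    then have "\<phi> x = (+) (c *\<^sub>R y) ` span {p}"
      using coset_eq_iff_mem[OF subspace_span] cy(2) by metis
    then show ?thesis using cy(1) by blast
  qed
  then show "\<phi> \<in> Hom_quot (span {p}) Y"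
    using * unfolding Hom_quot_def PiE_def Pi_def by blast
qed

lemma Hom_quot_exists:
  assumes "p \<noteq> 0"
  shows "\<exists>\<phi>\<in>Hom_quot (span {p}) UNIV. \<phi> p = (+) y ` span {p}"
proof -
  define \<alpha> where "\<alpha> x = (p \<bullet> x) / (p \<bullet> p)" for x
  have \<alpha>: "\<alpha> (x + x') = \<alpha> x + \<alpha> x'" "\<alpha> (c *\<^sub>R x) = c * \<alpha> x" "\<alpha> p = 1" for x x' c
    using assms by (auto simp: \<alpha>_def inner_add_right add_divide_distrib)
  define \<phi> where "\<phi> = (\<lambda>x\<in>span {p}. (+) (\<alpha> x *\<^sub>R y) ` span {p})"
  have "\<phi> \<in> Hom_quot (span {p}) UNIV"
    unfolding Hom_quot_def
  proof (intro CollectI conjI ballI allI)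
    show "\<phi> \<in> span {p} \<rightarrow>\<^sub>E {(+) y ` span {p} | y. y \<in> UNIV}"
      unfolding \<phi>_def by auto
  next
    fix x x' z z' assume x: "x \<in> span {p}" "x' \<in> span {p}" "z \<in> \<phi> x" "z' \<in> \<phi> x'"
    then obtain w w' where "z = \<alpha> x *\<^sub>R y + w" "z' = \<alpha> x' *\<^sub>R y + w'" "w \<in> span {p}" "w' \<in> span {p}"
      unfolding \<phi>_def by auto
    then have "z + z' = \<alpha> (x + x') *\<^sub>R y + (w + w')" "w + w' \<in> span {p}"
      using \<alpha> by (auto simp: algebra_simps span_add)
    then show "z + z' \<in> \<phi> (x + x')" using x unfolding \<phi>_def by (simp add: span_add)
  next
    fix c x z assume x: "x \<in> span {p}" "z \<in> \<phi> x"
    then obtain w where "z = \<alpha> x *\<^sub>R y + w" "w \<in> span {p}"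
      unfolding \<phi>_def by auto
    then have "c *\<^sub>R z = \<alpha> (c *\<^sub>R x) *\<^sub>R y + c *\<^sub>R w" "c *\<^sub>R w \<in> span {p}"
      using \<alpha> by (auto simp: algebra_simps span_scale)
    then show "c *\<^sub>R z \<in> \<phi> (c *\<^sub>R x)" using x unfolding \<phi>_def by (simp add: span_scale)
  qed
  moreover have "\<phi> p = (+) y ` span {p}" unfolding \<phi>_def by (simp add: \<alpha> span_base)
  ultimately show ?thesis by blast
qed

text \<open>Every vector of \<open>Y\<close> lies in the value of some homomorphism, so \<open>Y\<close> can be recovered. This makes the
  fibre of the bundle well defined.\<close>

lemma Hom_quot_inject:
  assumes "p \<noteq> 0" and "subspace Y" "span {p} \<subseteq> Y" and "subspace Z" "span {p} \<subseteq> Z"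
    and "Hom_quot (span {p}) Y = Hom_quot (span {p}) Z"
  shows "Y = Z"
proof -
  have "y \<in> Y \<longleftrightarrow> y \<in> Z" for y
  proof -
    obtain \<phi> where \<phi>: "\<phi> \<in> Hom_quot (span {p}) UNIV" "\<phi> p = (+) y ` span {p}"
      using Hom_quot_exists[OF assms(1)] by blast
    have *: "\<phi> p \<subseteq> T \<longleftrightarrow> y \<in> T" if "subspace T" "span {p} \<subseteq> T" for T
    proof
      assume "\<phi> p \<subseteq> T"
      moreover have "y \<in> \<phi> p" using \<phi>(2) span_zero[of "{p}"] by force
      ultimately show "y \<in> T" by blast
    next
      assume "y \<in> T" then show "\<phi> p \<subseteq> T" using \<phi>(2) that by (auto intro!: subspace_add)
    qed
    show ?thesis
      using *[OF assms(2,3)] *[OF assms(4,5)] \<phi>(1) assms Hom_quot_iff by metis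
  qed
  then show ?thesis by blast
qed

context manifold_chart
begin

lemma P_nonzero: "u \<in> U \<Longrightarrow> P u \<noteq> 0"
  using P_a by fastforce

lemma P'_e:
  assumes "u \<in> U" shows "P' u e = 0"
proof -
  have "((\<lambda>s::real. u + s *\<^sub>R e) has_derivative (\<lambda>s. s *\<^sub>R e)) (at 0)"
    by (auto intro!: derivative_eq_intros)
  moreover have "(P has_derivative P' u) (at (u + 0 *\<^sub>R e))" using P_deriv[OF assms] by simp
  ultimately have "((\<lambda>s::real. P (u + s *\<^sub>R e)) has_derivative (\<lambda>s. P' u (s *\<^sub>R e))) (at 0)"
    by (rule has_derivative_compose)
  then have "((\<lambda>s::real. P u) has_derivative (\<lambda>s. P' u (s *\<^sub>R e))) (at 0)"
    by (simp add: P_cyl[OF assms])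
  from has_derivative_unique[OF this has_derivative_const] have "P' u (1 *\<^sub>R e) = 0" by metis
  then show ?thesis by simp
qed

lemma a_P':
  assumes "u \<in> U" shows "a \<bullet> P' u v = 0"
proof -
  have "((\<lambda>u. a \<bullet> P u) has_derivative (\<lambda>v. a \<bullet> P' u v)) (at u)"
    by (rule has_derivative_inner_right[OF P_deriv[OF assms]])
  then have "((\<lambda>u. 1) has_derivative (\<lambda>v. a \<bullet> P' u v)) (at u)"
    by (rule has_derivative_transform_within_open[OF _ open_U assms P_a])
  from has_derivative_unique[OF this has_derivative_const] show ?thesis by metis
qed

text \<open>Near time 0 the curve is \<open>P\<close> applied to its own coordinates \<open>R (c t)\<close>, which are differentiable.\<close>

lemma velocity_in_range:
  assumes u: "u \<in> U" and c: "(c has_vector_derivative c') (at 0)" "c 0 = P u"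
    and M: "\<forall>\<^sub>F t in at 0. a \<bullet> c t = 1 \<and> span {c t} \<in> X"
  shows "\<exists>v. c' = P' u v"
proof -
  obtain R' where R': "(R has_derivative R') (at (c 0))"
    using R_diff[OF P_N[OF u]] c(2) unfolding differentiable_def by auto
  define r where "r t = R (c t) + (u \<bullet> e) *\<^sub>R e" for t
  have "((\<lambda>t. R (c t)) has_derivative (\<lambda>s. R' (s *\<^sub>R c'))) (at 0)"
    using has_derivative_compose[OF c(1)[unfolded has_vector_derivative_def] R'] .
  from has_derivative_add[OF this has_derivative_const]
  have r: "(r has_derivative (\<lambda>s. R' (s *\<^sub>R c'))) (at 0)" unfolding r_def by simp
  have r0: "r 0 = u" unfolding r_def c(2) R_P[OF u] by simp
  have D: "((\<lambda>t. P (r t)) has_derivative (\<lambda>s. P' u (R' (s *\<^sub>R c')))) (at 0)"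
    by (rule has_derivative_compose[OF r]) (use r0 P_deriv[OF u] in simp)
  have "\<forall>\<^sub>F t in at 0. P (r t) = c t"
  proof -
    have "(c \<longlongrightarrow> P u) (at 0)"
      using has_vector_derivative_continuous[OF c(1)] c(2) by (simp add: continuous_within)
    then have "\<forall>\<^sub>F t in at 0. c t \<in> N" using open_N P_N[OF u] by (rule topological_tendstoD)
    with M show ?thesis
      by eventually_elim (simp add: r_def P_cyl R_U P_R)
  qed
  then obtain d where d: "d > 0" "\<And>t. t \<noteq> 0 \<Longrightarrow> dist t 0 < d \<Longrightarrow> P (r t) = c t"
    unfolding eventually_at by blast
  have "P (r t) = c t" if "dist t 0 < d" for t
    using d(2)[of t] that r0 c(2) by (cases "t = 0") auto
  then have "(c has_derivative (\<lambda>s. P' u (R' (s *\<^sub>R c')))) (at 0)"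
    by (intro has_derivative_transform_within[OF D d(1)]) auto
  from has_derivative_unique[OF this c(1)[unfolded has_vector_derivative_def]]
  have "P' u (R' (1 *\<^sub>R c')) = 1 *\<^sub>R c'" by metis
  then show ?thesis by (metis scaleR_one)
qed

text \<open>The tangent space at \<open>P u\<close> of the cone over \<open>X\<close>, in terms of the parametrization.\<close>

definition cone_tangent_space :: "'w \<Rightarrow> 'v set" where
  "cone_tangent_space u = {s *\<^sub>R P u + P' u v | s v. True}"

lemma subspace_cone_tangent_space: "subspace (cone_tangent_space u)"
proof (rule subspaceI)
  have "0 = 0 *\<^sub>R P u + P' u 0" by (simp add: blinfun.bilinear_simps)
  then show "0 \<in> cone_tangent_space u" unfolding cone_tangent_space_def by blast
next
  fix x y assume "x \<in> cone_tangent_space u" "y \<in> cone_tangent_space u"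
  then obtain s v s' v' where "x = s *\<^sub>R P u + P' u v" "y = s' *\<^sub>R P u + P' u v'"
    unfolding cone_tangent_space_def by blast
  then have "x + y = (s + s') *\<^sub>R P u + P' u (v + v')"
    by (simp add: blinfun.bilinear_simps algebra_simps)
  then show "x + y \<in> cone_tangent_space u" unfolding cone_tangent_space_def by blast
next
  fix c x assume "x \<in> cone_tangent_space u"
  then obtain s v where "x = s *\<^sub>R P u + P' u v" unfolding cone_tangent_space_def by blast
  then have "c *\<^sub>R x = (c * s) *\<^sub>R P u + P' u (c *\<^sub>R v)"
    by (simp add: blinfun.bilinear_simps algebra_simps)
  then show "c *\<^sub>R x \<in> cone_tangent_space u" unfolding cone_tangent_space_def by blast
qed

lemma span_subset_cone_tangent_space: "span {P u} \<subseteq> cone_tangent_space u"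
proof -
  have "P u = 1 *\<^sub>R P u + P' u 0" by (simp add: blinfun.bilinear_simps)
  then have "P u \<in> cone_tangent_space u" unfolding cone_tangent_space_def by blast
  then show ?thesis by (simp add: span_minimal subspace_cone_tangent_space)
qed

text \<open>A curve of representatives is rescaled so that it stays in the affine chart. This changes its
  velocity by a multiple of \<open>P u\<close> and by a factor, both of which are invisible modulo the line.\<close>

lemma proj_tangent_space_chart:
  assumes u: "u \<in> U"
  shows "proj_tangent_space X (span {P u}) = Hom_quot (span {P u}) (cone_tangent_space u)"
proof -
  let ?p = "P u" let ?l = "span {P u}" let ?Y = "cone_tangent_space u"
  note iff = Hom_quot_iff[OF P_nonzero[OF u] subspace_cone_tangent_space[of u] span_subset_cone_tangent_space[of u]]
  have "\<phi> \<in> proj_tangent_space X ?l \<longleftrightarrow> \<phi> \<in> Hom_quot ?l UNIV \<and> \<phi> ?p \<subseteq> ?Y" for \<phi>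
  proof
    assume "\<phi> \<in> proj_tangent_space X ?l"
    then obtain \<epsilon> w where \<phi>: "\<phi> \<in> Hom_quot ?l UNIV" and \<epsilon>: "\<epsilon> > 0" and sm: "smooth_on {-\<epsilon><..<\<epsilon>} w"
      and w: "\<And>t. t \<in> {-\<epsilon><..<\<epsilon>} \<Longrightarrow> w t \<noteq> 0 \<and> span {w t} \<in> X" and w0: "span {w 0} = ?l"
      and v: "vector_derivative w (at 0) \<in> \<phi> (w 0)"
      unfolding proj_tangent_space_def by blast
    define w' where "w' = vector_derivative w (at 0)"
    have D: "(w has_vector_derivative w') (at 0)"
      using smooth_on_interval_has_vector_derivative[OF sm \<epsilon>] unfolding w'_def .
    have "w 0 \<in> ?l" using w0 by (metis singletonI span_base)
    then obtain k where k: "w 0 = k *\<^sub>R ?p" by (auto simp: span_singleton)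
    have k0: "k \<noteq> 0" using k w[of 0] \<epsilon> by auto
    have ak: "a \<bullet> w 0 = k" using k P_a[OF u] by simp
    \<comment> \<open>the curve in the affine chart that spans the same lines\<close>
    define c where "c t = inverse (a \<bullet> w t) *\<^sub>R w t" for t
    have Da: "((\<lambda>t. a \<bullet> w t) has_real_derivative a \<bullet> w') (at 0)"
      using has_derivative_inner_right[OF D[unfolded has_vector_derivative_def], of a]
      by (simp add: has_field_derivative_def mult_commute_abs)
    have "((\<lambda>t. inverse (a \<bullet> w t)) has_real_derivative - (inverse k * (a \<bullet> w') * inverse k)) (at 0)"
      using DERIV_inverse'[OF Da] ak k0 by simp
    from has_vector_derivative_scaleR[OF this D]
    have Dc: "(c has_vector_derivative
        (inverse k *\<^sub>R w' + (- (inverse k * (a \<bullet> w') * inverse k)) *\<^sub>R w 0)) (at 0)"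
      unfolding c_def ak .
    have "((\<lambda>t. a \<bullet> w t) \<longlongrightarrow> k) (at 0)"
      using DERIV_isCont[OF Da] ak by (simp add: isCont_def)
    then have "\<forall>\<^sub>F t in at 0. a \<bullet> w t \<noteq> 0" using k0 by (rule tendsto_imp_eventually_ne)
    moreover have "\<forall>\<^sub>F t in at 0. t \<in> {-\<epsilon><..<\<epsilon>}"
      using \<epsilon> by (intro eventually_at_in_open') auto
    ultimately have ev: "\<forall>\<^sub>F t in at 0. a \<bullet> c t = 1 \<and> span {c t} \<in> X"
    proof eventually_elim
      case (elim t)
      have "span {c t} = span {w t}"
        unfolding c_def using elim(1) by (simp add: span_image_scale[of "{w t}" "\<lambda>_. inverse (a \<bullet> w t)", simplified])
      then show ?case using w[OF elim(2)] elim(1) by (simp add: c_def)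
    qed
    have "c 0 = ?p" unfolding c_def ak using k k0 by simp
    from velocity_in_range[OF u Dc this ev] obtain x where
      x: "inverse k *\<^sub>R w' + (- (inverse k * (a \<bullet> w') * inverse k)) *\<^sub>R w 0 = P' u x" by blast
    then have "inverse k *\<^sub>R w' = (inverse k * (a \<bullet> w')) *\<^sub>R ?p + P' u x"
      unfolding k using k0 by (simp add: algebra_simps)
    then have inY: "inverse k *\<^sub>R w' \<in> ?Y" unfolding cone_tangent_space_def by blast
    have "inverse k *\<^sub>R w' \<in> \<phi> (inverse k *\<^sub>R w 0)"
      using Hom_quot_scale[OF \<phi> \<open>w 0 \<in> ?l\<close>] v unfolding w'_def by blast
    then have "inverse k *\<^sub>R w' \<in> \<phi> ?p" using k k0 by simp
    then have "\<phi> ?p = (+) (inverse k *\<^sub>R w') ` ?l"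
      using Hom_quot_coset[OF \<phi>, of ?p] coset_eq_iff_mem[OF subspace_span]
      by (metis singletonI span_base)
    then have "\<phi> ?p \<subseteq> ?Y"
      using inY span_subset_cone_tangent_space[of u] subspace_cone_tangent_space[of u] by (auto intro!: subspace_add)
    then show "\<phi> \<in> Hom_quot ?l UNIV \<and> \<phi> ?p \<subseteq> ?Y" using \<phi> by blast
  next
    assume \<phi>: "\<phi> \<in> Hom_quot ?l UNIV \<and> \<phi> ?p \<subseteq> ?Y"
    then obtain y where y: "\<phi> ?p = (+) y ` ?l"
      using Hom_quot_coset[of \<phi> ?l UNIV ?p] by (auto simp: span_base)
    then have "y \<in> ?Y" using \<phi> span_zero[of "{?p}"] by force
    then obtain s v where sv: "y = s *\<^sub>R ?p + P' u v" unfolding cone_tangent_space_def by blast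
    have "P' u v = y + (-s) *\<^sub>R ?p" using sv by simp
    moreover have "(-s) *\<^sub>R ?p \<in> ?l" by (intro span_scale span_base) simp
    ultimately have mem: "P' u v \<in> \<phi> ?p" unfolding y by (rule image_eqI)
    obtain \<epsilon> where \<epsilon>: "\<epsilon> > 0" "smooth_on {-\<epsilon><..<\<epsilon>} (\<lambda>t. P (u + t *\<^sub>R v))" using P_curve[OF u] by blast
    have "open ((\<lambda>t. u + t *\<^sub>R v) -` U)"
      by (intro open_vimage open_U continuous_intros)
    moreover have "(0::real) \<in> (\<lambda>t. u + t *\<^sub>R v) -` U" using u by simp
    ultimately obtain \<delta> where \<delta>: "\<delta> > 0" "ball 0 \<delta> \<subseteq> (\<lambda>t::real. u + t *\<^sub>R v) -` U"
      using open_contains_ball by blast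
    define \<eta> where "\<eta> = min \<epsilon> \<delta>"
    have "{-\<eta><..<\<eta>} \<subseteq> {-\<epsilon><..<\<epsilon>}" by (rule subsetI) (auto simp: \<eta>_def min_def split: if_splits)
    from smooth_on_subset[OF \<epsilon>(2) this]
    have \<eta>: "\<eta> > 0" "smooth_on {-\<eta><..<\<eta>} (\<lambda>t. P (u + t *\<^sub>R v))"
      using \<epsilon>(1) \<delta>(1) by (simp_all add: \<eta>_def)
    have inU: "u + t *\<^sub>R v \<in> U" if "t \<in> {-\<eta><..<\<eta>}" for t
      using that \<delta>(2) by (auto simp: \<eta>_def subset_iff dist_real_def)
    have "((\<lambda>t::real. u + t *\<^sub>R v) has_derivative (\<lambda>s. s *\<^sub>R v)) (at 0)"
      by (auto intro!: derivative_eq_intros)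
    moreover have "(P has_derivative P' u) (at (u + 0 *\<^sub>R v))" using P_deriv[OF u] by simp
    ultimately have "((\<lambda>s::real. P (u + s *\<^sub>R v)) has_derivative (\<lambda>s. P' u (s *\<^sub>R v))) (at 0)"
      by (rule has_derivative_compose)
    then have vd: "vector_derivative (\<lambda>t. P (u + t *\<^sub>R v)) (at 0) = P' u v"
      by (intro vector_derivative_at) (simp add: has_vector_derivative_def blinfun.bilinear_simps)
    show "\<phi> \<in> proj_tangent_space X ?l"
      unfolding proj_tangent_space_def
      using \<phi> \<eta> inU P_nonzero P_X mem vd
      by (intro CollectI conjI exI[of _ \<eta>] exI[of _ "\<lambda>t. P (u + t *\<^sub>R v)"]) auto
  qed
  then show ?thesis using iff by blast
qed

lemma Y_fibre_chart:
  assumes u: "u \<in> U"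
  shows "Y_fibre X (span {P u}) = cone_tangent_space u"
  unfolding Y_fibre_def
proof (rule the_equality)
  show "subspace (cone_tangent_space u) \<and> span {P u} \<subseteq> cone_tangent_space u \<and>
      proj_tangent_space X (span {P u}) = Hom_quot (span {P u}) (cone_tangent_space u)"
    using subspace_cone_tangent_space span_subset_cone_tangent_space proj_tangent_space_chart[OF u] by blast
next
  fix Y assume "subspace Y \<and> span {P u} \<subseteq> Y \<and>
      proj_tangent_space X (span {P u}) = Hom_quot (span {P u}) Y"
  then show "Y = cone_tangent_space u"
    using Hom_quot_inject[OF P_nonzero[OF u] _ _ subspace_cone_tangent_space[of u] span_subset_cone_tangent_space[of u]]
      proj_tangent_space_chart[OF u] by metis
qed

end

section \<open>Leaving the wall\<close>

lemma span_in_proj_iff: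
  assumes "x \<noteq> 0" and "subspace K"
  shows "span {x} \<in> proj K \<longleftrightarrow> x \<in> K"
  using assms by (auto simp: proj_def dim_insert span_base intro: span_minimal[THEN subsetD])

lemma proj_eq_span:
  assumes "l \<in> proj K" and "x \<in> l" and "x \<noteq> 0"
  shows "l = span {x}"
proof -
  have "l \<in> proj UNIV" using assms(1) by (simp add: proj_def)
  moreover have "span {x} \<in> proj UNIV" using assms(3) by (simp add: span_in_proj_iff)
  ultimately show ?thesis
    using assms(2,3) by (intro proj_Int[of _ _ x]) (auto simp: span_base)
qed

lemma proj_unit_vector:
  assumes "l \<in> proj K"
  obtains x where "norm x = 1" "l = span {x}" "x \<in> K"
proof -
  have l: "subspace l" "dim l = 1" "l \<subseteq> K" using assms by (auto simp: proj_def)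
  then obtain y where y: "y \<in> l" "y \<noteq> 0"
    by (metis dim_eq_0 subset_singletonD singletonI subsetI zero_neq_one)
  let ?x = "inverse (norm y) *\<^sub>R y"
  have x: "?x \<in> l" "?x \<noteq> 0" "norm ?x = 1" using y l(1) by (auto simp: subspace_scale)
  then show thesis using that[of ?x] proj_eq_span[OF assms x(1,2)] l(3) by blast
qed

lemma span_scale_singleton: "c \<noteq> 0 \<Longrightarrow> span {c *\<^sub>R x} = span {x}"
  using span_image_scale[of "{x}" "\<lambda>_. c"] by simp

lemma subspace_ker: "subspace (ker f)"
  by (auto simp: subspace_def ker_def blinfun.bilinear_simps)

text \<open>Unit vectors represent the lines of \<open>X\<close> in a compact subset of \<open>V\<close>.\<close>

definition unit_cone :: "'v::euclidean_space set set \<Rightarrow> 'v set" where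
  "unit_cone X = {x. norm x = 1 \<and> span {x} \<in> X}"

lemma wall_iff_unit_cone:
  assumes "X \<subseteq> proj UNIV"
  shows "f \<in> wall X \<longleftrightarrow> (\<exists>x\<in>unit_cone X. blinfun_apply f x = 0)"
proof
  assume "f \<in> wall X"
  then obtain l where l: "l \<in> X" "l \<in> proj (ker f)" unfolding wall_def Hom_X_def by blast
  obtain x where "norm x = 1" "l = span {x}" "x \<in> ker f" by (rule proj_unit_vector[OF l(2)])
  then show "\<exists>x\<in>unit_cone X. blinfun_apply f x = 0"
    using l(1) unfolding unit_cone_def ker_def by auto
next
  assume "\<exists>x\<in>unit_cone X. blinfun_apply f x = 0"
  then obtain x where x: "norm x = 1" "span {x} \<in> X" "blinfun_apply f x = 0"
    unfolding unit_cone_def by blast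
  then have "span {x} \<in> proj (ker f)"
    by (subst span_in_proj_iff[OF _ subspace_ker]) (auto simp: ker_def)
  then show "f \<in> wall X" using x unfolding wall_def Hom_X_def by blast
qed

text \<open>If unit vectors of lines in \<open>X\<close> converge to \<open>x\<close> and the line of \<open>x\<close> is not in \<open>X\<close>, then the sets of
  lines that make an angle of cosine less than \<open>1 - 1/(n + 1)\<close> with \<open>x\<close> form an open cover of \<open>X\<close> without a
  finite subcover.\<close>

lemma compact_unit_cone:
  fixes X :: "'v::euclidean_space set set"
  assumes X: "compactin proj_topology X"
  shows "compact (unit_cone X)"
proof -
  have sub: "X \<subseteq> proj UNIV"
    using compactin_subset_topspace[OF X] openin_proj_topology[of "topspace proj_topology"] by auto
  have "closed (unit_cone X)"
    unfolding closed_sequential_limits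
  proof (intro allI impI)
    fix s x assume "(\<forall>n. s n \<in> unit_cone X) \<and> s \<longlonglongrightarrow> x"
    then have s: "\<And>n. norm (s n) = 1" "\<And>n. span {s n} \<in> X" "s \<longlonglongrightarrow> x"
      unfolding unit_cone_def by auto
    have nx: "norm x = 1" using tendsto_norm[OF s(3)] s(1) by (simp add: LIMSEQ_const_iff)
    have "span {x} \<in> X"
    proof (rule ccontr)
      assume notin: "span {x} \<notin> X"
      define G where "G n = {l \<in> proj UNIV. \<forall>y\<in>l - {0}. \<bar>y \<bullet> x\<bar> < (1 - inverse (real (Suc n))) * norm y}"
        for n
      have UG: "\<Union>(G n) - {0} = {y. \<bar>y \<bullet> x\<bar> < (1 - inverse (real (Suc n))) * norm y} - {0}" for n
      proof (intro equalityI subsetI)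
        fix y assume "y \<in> \<Union>(G n) - {0}"
        then show "y \<in> {y. \<bar>y \<bullet> x\<bar> < (1 - inverse (real (Suc n))) * norm y} - {0}"
          unfolding G_def by blast
      next
        fix y assume y: "y \<in> {y. \<bar>y \<bullet> x\<bar> < (1 - inverse (real (Suc n))) * norm y} - {0}"
        have "\<bar>z \<bullet> x\<bar> < (1 - inverse (real (Suc n))) * norm z" if zl: "z \<in> span {y} - {0}" for z
        proof -
          obtain c where c: "z = c *\<^sub>R y" using zl by (auto simp: span_singleton)
          then have c0: "c \<noteq> 0" using zl by auto
          have "\<bar>c\<bar> * \<bar>y \<bullet> x\<bar> < \<bar>c\<bar> * ((1 - inverse (real (Suc n))) * norm y)"
            using y c0 by (intro mult_strict_left_mono) auto
          then show ?thesis unfolding c by (simp add: abs_mult algebra_simps)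
        qed
        moreover have "span {y} \<in> proj UNIV" using y by (subst span_in_proj_iff) auto
        ultimately have "span {y} \<in> G n" unfolding G_def by blast
        then show "y \<in> \<Union>(G n) - {0}" using y by (auto intro: span_base)
      qed
      have "openin proj_topology (G n)" for n
        unfolding openin_proj_topology UG
        by (intro conjI open_Diff open_Collect_less closed_singleton continuous_intros) (auto simp: G_def)
      moreover have "X \<subseteq> \<Union>(range G)"
      proof
        fix l assume l: "l \<in> X"
        then obtain y where y: "norm y = 1" "l = span {y}" using sub proj_unit_vector by blast
        have "\<bar>y \<bullet> x\<bar> \<noteq> 1"
        proof
          assume "\<bar>y \<bullet> x\<bar> = 1"
          then have "y = x \<or> y = - x"
            using norm_cauchy_schwarz_abs_eq[of y x] y nx by auto
          then have "span {x} = span {y}" using span_scale_singleton[of "-1" x] by auto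
          then show False using notin l y by simp
        qed
        moreover have "\<bar>y \<bullet> x\<bar> \<le> 1" using Cauchy_Schwarz_ineq2[of y x] y nx by simp
        ultimately have "0 < 1 - \<bar>y \<bullet> x\<bar>" by simp
        then obtain n where n: "inverse (real (Suc n)) < 1 - \<bar>y \<bullet> x\<bar>" using reals_Archimedean by blast
        have "\<bar>z \<bullet> x\<bar> < (1 - inverse (real (Suc n))) * norm z" if zl: "z \<in> l - {0}" for z
        proof -
          obtain c where c: "z = c *\<^sub>R y" using zl y by (auto simp: span_singleton)
          then have c0: "c \<noteq> 0" using zl by auto
          have "\<bar>c\<bar> * \<bar>y \<bullet> x\<bar> < \<bar>c\<bar> * (1 - inverse (real (Suc n)))"
            using n c0 by (intro mult_strict_left_mono) auto
          then show ?thesis unfolding c using y by (simp add: abs_mult algebra_simps)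
        qed
        then have "l \<in> G n" using l sub unfolding G_def by blast
        then show "l \<in> \<Union>(range G)" by blast
      qed
      ultimately obtain \<F> where F: "finite \<F>" "\<F> \<subseteq> range G" "X \<subseteq> \<Union>\<F>"
        using X unfolding compactin_def by (metis (no_types, lifting) imageE)
      then obtain I where I: "finite I" "\<F> = G ` I" using finite_subset_image by metis
      have bound: "\<bar>s k \<bullet> x\<bar> \<le> 1 - inverse (real (Suc (Max I)))" for k
      proof -
        obtain i where i: "i \<in> I" "span {s k} \<in> G i" using F(3) I s(2)[of k] by blast
        have "s k \<in> span {s k} - {0}" using s(1)[of k] by (auto simp: span_base)
        then have "\<bar>s k \<bullet> x\<bar> < (1 - inverse (real (Suc i))) * norm (s k)"
          using i(2) unfolding G_def by blast
        moreover have "inverse (real (Suc (Max I))) \<le> inverse (real (Suc i))"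
          using I(1) i(1) by (intro le_imp_inverse_le) auto
        ultimately show ?thesis unfolding s(1) mult_1_right by linarith
      qed
      have "(\<lambda>k. \<bar>s k \<bullet> x\<bar>) \<longlonglongrightarrow> \<bar>x \<bullet> x\<bar>" by (intro tendsto_intros s(3))
      then have "\<bar>x \<bullet> x\<bar> \<le> 1 - inverse (real (Suc (Max I)))"
        by (rule LIMSEQ_le_const2) (use bound in blast)
      moreover have "x \<bullet> x = 1" using nx by (simp add: norm_eq_1)
      moreover have "inverse (real (Suc (Max I))) > 0" by simp
      ultimately show False by linarith
    qed
    then show "x \<in> unit_cone X" using nx unfolding unit_cone_def by blast
  qed
  moreover have "bounded (unit_cone X)"
    unfolding unit_cone_def bounded_iff by (intro exI[of _ 1]) auto
  ultimately show ?thesis by (simp add: compact_eq_bounded_closed)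
qed

text \<open>The derivative is bounded below by a multiple of the norm and dominates the error of the first order
  approximation.\<close>

lemma isolated_zero:
  fixes f :: "'a::euclidean_space \<Rightarrow> 'b::euclidean_space"
  assumes D: "(f has_derivative D) (at x)" and inj: "\<And>v. D v = 0 \<Longrightarrow> v = 0" and "f x = 0"
  shows "\<forall>\<^sub>F y in at x. f y \<noteq> 0"
proof -
  have lin: "linear D" using D has_derivative_linear by blast
  then have "inj D" using inj linear_injective_0 by blast
  then obtain B where B: "B > 0" "\<And>v. B * norm v \<le> norm (D v)"
    using linear_inj_bounded_below_pos[OF lin] by blast
  have "\<forall>\<^sub>F y in at x. norm (f y - f x - D (y - x)) / norm (y - x) < B"
    using D B(1) unfolding has_derivative_iff_norm by (intro order_tendstoD(2)[where y = 0]) auto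
  moreover have "\<forall>\<^sub>F y in at x. y \<noteq> x" by (simp add: eventually_at_filter)
  ultimately show ?thesis
  proof eventually_elim
    case (elim y)
    show ?case
    proof
      assume "f y = 0"
      then have "norm (D (y - x)) < B * norm (y - x)"
        using elim \<open>f x = 0\<close> by (simp add: divide_less_eq)
      then show False using B(2)[of "y - x"] by simp
    qed
  qed
qed

context manifold_chart
begin

text \<open>Injectivity of the derivative at \<open>u\<close> of \<open>u \<mapsto> c(u \<bullet> e) (P u)\<close> for a path \<open>c\<close> with value \<open>f\<close> and velocity
  \<open>D\<close> at the time \<open>u \<bullet> e\<close>.\<close>

definition nondegenerate_at :: "'w \<Rightarrow> ('v \<Rightarrow>\<^sub>L 'w) \<Rightarrow> ('v \<Rightarrow>\<^sub>L 'w) \<Rightarrow> bool" where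
  "nondegenerate_at u f D \<longleftrightarrow> (\<forall>v. (v \<bullet> e) *\<^sub>R D (P u) + f (P' u v) = 0 \<longrightarrow> v = 0)"

text \<open>The key lemma. Wall points \<open>f (t n)\<close> at times tending to \<open>t0\<close> kill lines of \<open>X\<close>, which by compactness
  accumulate at the only line that \<open>f t0\<close> kills. In the chart each pair of a time and a line becomes a
  zero of \<open>\<Psi>\<close> near 0, while nondegeneracy makes 0 an isolated zero of \<open>\<Psi>\<close>. Since only the
  derivative of \<open>f\<close> at \<open>t0\<close> enters, the lemma applies to the path under construction and to all curves
  that are tangent to it.\<close>

lemma eventually_off_wall:
  fixes f :: "real \<Rightarrow> 'v \<Rightarrow>\<^sub>L 'w"
  assumes X: "compactin proj_topology X" and u: "u \<in> U"
    and D: "(f has_vector_derivative D) (at t0)"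
    and ker: "X \<inter> proj (ker (f t0)) = {span {P u}}"
    and nd: "nondegenerate_at u (f t0) D"
  shows "\<forall>\<^sub>F t in at t0. f t \<notin> wall X"
proof (rule ccontr)
  assume not: "\<not> (\<forall>\<^sub>F t in at t0. f t \<notin> wall X)"
  have sub: "X \<subseteq> proj UNIV"
    using compactin_subset_topspace[OF X] openin_proj_topology[of "topspace proj_topology"] by auto
  have "\<exists>t. t \<noteq> t0 \<and> dist t t0 < inverse (real (Suc n)) \<and> f t \<in> wall X" for n
  proof -
    have "\<not> (\<forall>t. t \<noteq> t0 \<and> dist t t0 < inverse (real (Suc n)) \<longrightarrow> f t \<notin> wall X)"
    proof
      assume "\<forall>t. t \<noteq> t0 \<and> dist t t0 < inverse (real (Suc n)) \<longrightarrow> f t \<notin> wall X"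
      then have "\<forall>\<^sub>F t in at t0. f t \<notin> wall X"
        unfolding eventually_at by (intro exI[of _ "inverse (real (Suc n))"]) simp
      then show False using not by blast
    qed
    then show ?thesis by blast
  qed
  then have "\<forall>n. \<exists>t. t \<noteq> t0 \<and> dist t t0 < inverse (real (Suc n)) \<and> f t \<in> wall X" ..
  from choice[OF this]
  obtain t where t: "\<And>n. t n \<noteq> t0" "\<And>n. dist (t n) t0 < inverse (real (Suc n))" "\<And>n. f (t n) \<in> wall X"
    by blast
  have tlim: "t \<longlonglongrightarrow> t0"
  proof (rule tendstoI)
    fix r :: real assume "r > 0"
    have "\<forall>\<^sub>F n in sequentially. inverse (real (Suc n)) < r"
      using order_tendstoD(2)[OF LIMSEQ_inverse_real_of_nat \<open>r > 0\<close>] .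
    then show "\<forall>\<^sub>F n in sequentially. dist (t n) t0 < r"
      by (rule eventually_mono) (rule less_trans[OF t(2)])
  qed
  have "\<forall>n. \<exists>x. x \<in> unit_cone X \<and> f (t n) x = 0" using t(3) wall_iff_unit_cone[OF sub] by auto
  from choice[OF this] obtain x where x: "\<And>n. x n \<in> unit_cone X" "\<And>n. f (t n) (x n) = 0" by blast
  obtain z r where r: "z \<in> unit_cone X" "strict_mono r" "(x \<circ> r) \<longlonglongrightarrow> z"
    using seq_compactE[of "unit_cone X" x] compact_unit_cone[OF X] x(1) compact_imp_seq_compact by blast
  have trlim: "(\<lambda>n. t (r n)) \<longlonglongrightarrow> t0" using LIMSEQ_subseq_LIMSEQ[OF tlim r(2)] by (simp add: o_def)
  have xrlim: "(\<lambda>n. x (r n)) \<longlonglongrightarrow> z" using r(3) by (simp add: o_def)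
  have fcont: "isCont f t0" using has_vector_derivative_continuous[OF D] .
  have "(\<lambda>n. f (t (r n)) (x (r n))) \<longlonglongrightarrow> f t0 z"
    by (intro blinfun.tendsto isCont_tendsto_compose[OF fcont] trlim xrlim)
  then have fz: "f t0 z = 0" using x(2) by (simp add: LIMSEQ_const_iff)
  have z: "norm z = 1" "span {z} \<in> X" using r(1) unfolding unit_cone_def by auto
  then have "span {z} \<in> proj (ker (f t0))"
    using fz by (subst span_in_proj_iff[OF _ subspace_ker]) (auto simp: ker_def)
  then have "span {z} = span {P u}" using ker z by blast
  then have "z \<in> span {P u}" by (metis singletonI span_base)
  then obtain k where k: "z = k *\<^sub>R P u" by (auto simp: span_singleton)
  have k0: "k \<noteq> 0" using k z by auto
  have az: "a \<bullet> z = k" using k P_a[OF u] by simp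
  have fP: "f t0 (P u) = 0" using fz k k0 by (simp add: blinfun.bilinear_simps)
  define y where "y n = inverse (a \<bullet> x (r n)) *\<^sub>R x (r n)" for n
  have alim: "(\<lambda>n. a \<bullet> x (r n)) \<longlonglongrightarrow> k" unfolding az[symmetric] by (intro tendsto_intros xrlim)
  have "y \<longlonglongrightarrow> inverse k *\<^sub>R z"
    unfolding y_def by (intro tendsto_intros alim xrlim k0)
  then have ylim: "y \<longlonglongrightarrow> P u" using k k0 by simp
  have ev: "\<forall>\<^sub>F n in sequentially. y n \<in> N \<and> a \<bullet> x (r n) \<noteq> 0"
    using topological_tendstoD[OF ylim open_N P_N[OF u]] tendsto_imp_eventually_ne[OF alim k0]
    by eventually_elim simp
  \<comment> \<open>the displacement in the chart that encodes the line through \<open>y n\<close> and the time \<open>t (r n)\<close>\<close>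
  define w where "w n = R (y n) - R (P u) + (t (r n) - t0) *\<^sub>R e" for n
  have "isCont R (P u)"
    using R_diff[OF P_N[OF u]] differentiable_imp_continuous_within by blast
  then have "(\<lambda>n. R (y n)) \<longlonglongrightarrow> R (P u)" using ylim by (rule isCont_tendsto_compose)
  then have "w \<longlonglongrightarrow> R (P u) - R (P u) + (t0 - t0) *\<^sub>R e"
    unfolding w_def by (intro tendsto_intros trlim)
  then have wlim: "w \<longlonglongrightarrow> 0" by simp
  have ee: "e \<bullet> e = 1" using norm_e by (simp add: norm_eq_1)
  have RPe: "R (P u) \<bullet> e = 0" using R_P[OF u] ee by (simp add: inner_diff_left)
  define \<Psi> where "\<Psi> v = f (t0 + v \<bullet> e) (P (u + v))" for v
  have "((\<lambda>v. t0 + v \<bullet> e) has_derivative (\<lambda>v. v \<bullet> e)) (at 0)"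
    by (auto intro!: derivative_eq_intros)
  moreover have "(f has_derivative (\<lambda>s. s *\<^sub>R D)) (at (t0 + 0 \<bullet> e))"
    using D by (simp add: has_vector_derivative_def)
  ultimately have D1: "((\<lambda>v. f (t0 + v \<bullet> e)) has_derivative (\<lambda>v. (v \<bullet> e) *\<^sub>R D)) (at 0)"
    by (rule has_derivative_compose)
  have "((\<lambda>v. u + v) has_derivative (\<lambda>v. v)) (at 0)"
    by (auto intro!: derivative_eq_intros)
  moreover have "(P has_derivative P' u) (at (u + 0))" using P_deriv[OF u] by simp
  ultimately have D2: "((\<lambda>v. P (u + v)) has_derivative P' u) (at 0)"
    by (rule has_derivative_compose)
  have "(\<Psi> has_derivative (\<lambda>v. f t0 (P' u v) + (v \<bullet> e) *\<^sub>R D (P u))) (at 0)"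
    using blinfun.FDERIV[OF D1 D2] unfolding \<Psi>_def by (simp add: blinfun.bilinear_simps)
  moreover have "v = 0" if "f t0 (P' u v) + (v \<bullet> e) *\<^sub>R D (P u) = 0" for v
  proof -
    have "(v \<bullet> e) *\<^sub>R D (P u) + f t0 (P' u v) = 0" using that by (subst add.commute)
    then show ?thesis using nd unfolding nondegenerate_at_def by blast
  qed
  moreover have "\<Psi> 0 = 0" unfolding \<Psi>_def using fP by simp
  ultimately have "\<forall>\<^sub>F v in at 0. \<Psi> v \<noteq> 0" by (rule isolated_zero)
  then have "\<forall>\<^sub>F v in nhds 0. v \<noteq> 0 \<longrightarrow> \<Psi> v \<noteq> 0" by (simp add: eventually_at_filter)
  then have "\<forall>\<^sub>F n in sequentially. w n \<noteq> 0 \<longrightarrow> \<Psi> (w n) \<noteq> 0"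
    using wlim by (rule eventually_compose_filterlim)
  with ev have "\<forall>\<^sub>F n in sequentially. False"
  proof eventually_elim
    case (elim n)
    have an: "a \<bullet> y n = 1" using elim(1) by (simp add: y_def)
    have "span {y n} = span {x (r n)}" using elim(1) unfolding y_def by (simp add: span_scale_singleton)
    then have Xn: "span {y n} \<in> X" using x(1) unfolding unit_cone_def by auto
    have yN: "y n \<in> N" using elim(1) by blast
    note RU = R_U[OF yN an Xn] P_R[OF yN an Xn]
    have "R (P (R (y n))) = R (y n) - (R (y n) \<bullet> e) *\<^sub>R e" by (rule R_P[OF RU(1)])
    then have "(R (y n) \<bullet> e) *\<^sub>R e = 0" using RU(2) by simp
    then have Re: "R (y n) \<bullet> e = 0" using norm_e by auto
    then have we: "w n \<bullet> e = t (r n) - t0" unfolding w_def using RPe ee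
      by (simp add: inner_diff_left inner_add_left)
    have "u + w n = R (y n) + (u \<bullet> e + (t (r n) - t0)) *\<^sub>R e"
      unfolding w_def R_P[OF u] by (simp add: algebra_simps)
    then have "P (u + w n) = y n" using P_cyl[OF RU(1)] RU(2) by simp
    then have "\<Psi> (w n) = 0" unfolding \<Psi>_def we
      using x(2)[of "r n"] by (simp add: y_def blinfun.bilinear_simps)
    moreover have "w n \<noteq> 0"
    proof
      assume "w n = 0"
      then have "t (r n) - t0 = 0" using we by (metis inner_zero_left)
      then show False using t(1)[of "r n"] by simp
    qed
    ultimately show False using elim(2) by simp
  qed
  then show False by simp
qed

lemma kernel_meets_cone_tangent_space:
  assumes u: "u \<in> U" and f: "blinfun_apply f (P u) = 0" and nd: "nondegenerate_at u f D"
  shows "ker f \<inter> cone_tangent_space u = span {P u}"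
proof
  show "span {P u} \<subseteq> ker f \<inter> cone_tangent_space u"
  proof (rule Int_greatest[OF _ span_subset_cone_tangent_space])
    have "{P u} \<subseteq> ker f" using f by (simp add: ker_def)
    then show "span {P u} \<subseteq> ker f" by (rule span_minimal[OF _ subspace_ker])
  qed
  show "ker f \<inter> cone_tangent_space u \<subseteq> span {P u}"
  proof
    fix x assume xin: "x \<in> ker f \<inter> cone_tangent_space u"
    then obtain s v where x: "x = s *\<^sub>R P u + P' u v"
      unfolding cone_tangent_space_def by auto
    have fx: "f x = 0" using xin by (simp add: ker_def)
    define v' where "v' = v - (v \<bullet> e) *\<^sub>R e"
    have v'e: "v' \<bullet> e = 0" using norm_e by (simp add: v'_def inner_diff_left norm_eq_1)
    have Pv: "P' u v' = P' u v" by (simp add: v'_def blinfun.bilinear_simps P'_e[OF u])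
    have "f (P' u v) = 0" using fx f unfolding x by (simp add: blinfun.bilinear_simps)
    then have "(v' \<bullet> e) *\<^sub>R D (P u) + f (P' u v') = 0" unfolding v'e Pv by simp
    then have "v' = 0" using nd unfolding nondegenerate_at_def by blast
    then have "P' u v = 0" using Pv by (metis blinfun.zero_right)
    then show "x \<in> span {P u}" using x by (simp add: span_scale span_base)
  qed
qed

end

section \<open>Generic perturbations of a segment\<close>

definition rank_one :: "'v::euclidean_space \<Rightarrow> 'w::euclidean_space \<Rightarrow> 'v \<Rightarrow>\<^sub>L 'w" where
  "rank_one a w = Blinfun (\<lambda>x. (a \<bullet> x) *\<^sub>R w)"

lemma rank_one_apply [simp]: "blinfun_apply (rank_one a w) x = (a \<bullet> x) *\<^sub>R w"
proof -
  have "bounded_linear (\<lambda>x. (a \<bullet> x) *\<^sub>R w)"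
    by (intro bounded_linear_scaleR_const bounded_linear_inner_right)
  then show ?thesis unfolding rank_one_def by (simp add: bounded_linear_Blinfun_apply)
qed

lemma bounded_linear_rank_one:
  "bounded_linear (\<lambda>w. rank_one a w)" "bounded_linear (\<lambda>a. rank_one a w)"
  unfolding linear_conv_bounded_linear[symmetric]
  by (auto intro!: linearI blinfun_eqI simp: blinfun.bilinear_simps algebra_simps inner_add_left)

definition perturbed_segment ::
    "('v::euclidean_space \<Rightarrow>\<^sub>L 'w::euclidean_space) \<Rightarrow> ('v \<Rightarrow>\<^sub>L 'w) \<Rightarrow> ('v \<Rightarrow>\<^sub>L 'w) \<Rightarrow> real \<Rightarrow> 'v \<Rightarrow>\<^sub>L 'w" where
  "perturbed_segment f0 f1 g t = f0 + t *\<^sub>R (f1 - f0) + (t * (1 - t)) *\<^sub>R g"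

definition perturbed_velocity ::
    "('v::euclidean_space \<Rightarrow>\<^sub>L 'w::euclidean_space) \<Rightarrow> ('v \<Rightarrow>\<^sub>L 'w) \<Rightarrow> ('v \<Rightarrow>\<^sub>L 'w) \<Rightarrow> real \<Rightarrow> 'v \<Rightarrow>\<^sub>L 'w" where
  "perturbed_velocity f0 f1 g t = f1 - f0 + (1 - 2 * t) *\<^sub>R g"

lemma perturbed_segment_ends:
  "perturbed_segment f0 f1 g 0 = f0" "perturbed_segment f0 f1 g 1 = f1"
  by (simp_all add: perturbed_segment_def)

lemma perturbed_segment_has_derivative:
  "(perturbed_segment f0 f1 g has_vector_derivative perturbed_velocity f0 f1 g t) (at t)"
proof -
  have "((\<lambda>t. f0 + t *\<^sub>R (f1 - f0) + (t * (1 - t)) *\<^sub>R g) has_derivative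
      (\<lambda>s. s *\<^sub>R (f1 - f0 + (1 - 2 * t) *\<^sub>R g))) (at t)"
    by (auto intro!: derivative_eq_intros simp: algebra_simps)
  then show ?thesis
    unfolding has_vector_derivative_def perturbed_segment_def[abs_def] perturbed_velocity_def .
qed

lemma smooth_perturbed_segment: "smooth_on S (perturbed_segment f0 f1 g)"
proof -
  have "perturbed_segment f0 f1 g = (\<lambda>t. f0 + t *\<^sub>R (f1 - f0 + g) + t\<^sup>2 *\<^sub>R (- g))"
    by (auto simp: perturbed_segment_def algebra_simps power2_eq_square)
  then have "Ck_on k (perturbed_segment f0 f1 g) UNIV" for k
    by (simp only: Ck_on_quadratic)
  then show ?thesis
    unfolding smooth_on_def by (intro ballI exI[of _ UNIV] exI[of _ "perturbed_segment f0 f1 g"]) simp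
qed

lemma perturbed_segment_add:
  "blinfun_apply (perturbed_segment f0 f1 (g + h) t) x =
    perturbed_segment f0 f1 g t x + (t * (1 - t)) *\<^sub>R h x"
  "blinfun_apply (perturbed_velocity f0 f1 (g + h) t) x =
    perturbed_velocity f0 f1 g t x + (1 - 2 * t) *\<^sub>R h x"
  by (simp_all add: perturbed_segment_def perturbed_velocity_def blinfun.bilinear_simps algebra_simps)

lemma continuous_on_perturbed:
  assumes "continuous_on S \<gamma>" "continuous_on S \<tau>" "continuous_on S x"
  shows "continuous_on S (\<lambda>c. blinfun_apply (perturbed_segment f0 f1 (\<gamma> c) (\<tau> c)) (x c))"
    and "continuous_on S (\<lambda>c. blinfun_apply (perturbed_velocity f0 f1 (\<gamma> c) (\<tau> c)) (x c))"
  unfolding perturbed_segment_def perturbed_velocity_def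
  by (intro blinfun.continuous_on continuous_on_add continuous_on_diff continuous_on_scaleR
      continuous_on_mult continuous_on_const assms)+

lemma differentiable_perturbed:
  assumes "\<tau> differentiable (at c)" "x differentiable (at c)"
  shows "(\<lambda>c. blinfun_apply (perturbed_segment f0 f1 g (\<tau> c)) (x c)) differentiable (at c)"
proof -
  have "(\<lambda>c. perturbed_segment f0 f1 g (\<tau> c)) differentiable (at c)"
    unfolding perturbed_segment_def
    by (intro differentiable_add differentiable_scaleR differentiable_mult differentiable_diff
        differentiable_const assms)
  then show ?thesis
    using assms(2) blinfun.FDERIV unfolding differentiable_def by blast
qed

lemma not_surj_functional:
  fixes f :: "'v::euclidean_space \<Rightarrow>\<^sub>L 'w::euclidean_space"
  assumes "\<not> surj (blinfun_apply f)"
  shows "\<exists>\<nu> b. b \<in> Basis \<and> \<nu> \<bullet> b = 1 \<and> (\<forall>x. \<nu> \<bullet> f x = 0)"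
proof -
  have "subspace (range (blinfun_apply f))"
    by (rule linear_subspace_image[OF bounded_linear.linear[OF blinfun.bounded_linear_right] subspace_UNIV])
  then have span: "span (range (blinfun_apply f)) = range (blinfun_apply f)" by (simp add: span_eq_iff)
  have "span (range (blinfun_apply f)) \<noteq> UNIV" unfolding span by (rule assms)
  from span_not_univ_subset_hyperplane[OF this] obtain \<mu> where
    \<mu>: "\<mu> \<noteq> 0" "span (range (blinfun_apply f)) \<subseteq> {x. \<mu> \<bullet> x = 0}" by blast
  have \<mu>f: "\<mu> \<bullet> f x = 0" for x
    using subsetD[OF \<mu>(2) span_base[of "f x" "range (blinfun_apply f)"]] by simp
  obtain b where b: "b \<in> Basis" "\<mu> \<bullet> b \<noteq> 0" using \<mu>(1) euclidean_all_zero_iff by blast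
  show ?thesis
    by (intro exI[of _ "inverse (\<mu> \<bullet> b) *\<^sub>R \<mu>"] exI[of _ b]) (use b \<mu>f in simp)
qed

text \<open>For a functional normalised by \<open>\<nu> \<bullet> b = 1\<close>, the perturbation \<open>x \<mapsto> (s \<bullet> x) b\<close> changes \<open>\<nu> \<circ> \<gamma>(t)\<close> by
  \<open>t (1 - t) s\<close>. So the bad \<open>s\<close> is determined by \<open>(t, \<nu>)\<close>, which ranges over a hyperplane of a space
  of dimension at most \<open>dim V\<close>.\<close>

lemma thin_not_surjective:
  fixes f0 f1 :: "'v::euclidean_space \<Rightarrow>\<^sub>L 'w::euclidean_space"
  assumes dim: "DIM('w) < DIM('v)"
  shows "thin {g. \<exists>t. 0 < t \<and> t < 1 \<and> \<not> surj (blinfun_apply (perturbed_segment f0 f1 g t))}"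
proof -
  define C :: "(real \<times> 'w) set" where "C = {0<..<1} \<times> UNIV"
  define adj where "adj g t \<nu> = (\<Sum>i\<in>Basis. (\<nu> \<bullet> blinfun_apply (perturbed_segment f0 f1 g t) i) *\<^sub>R i)"
    for g :: "'v \<Rightarrow>\<^sub>L 'w" and t :: real and \<nu> :: 'w
  define F where "F b c g = (adj g (fst c) (snd c), snd c \<bullet> b - 1)" for b :: 'w and c :: "real \<times> 'w" and g
  have adj0: "adj g t \<nu> = 0 \<longleftrightarrow> (\<forall>i\<in>Basis. \<nu> \<bullet> perturbed_segment f0 f1 g t i = 0)" for g t \<nu>
    unfolding adj_def euclidean_eq_iff[of _ "0 :: 'v"] by (simp add: inner_sum_left_Basis)
  have "thin {g. \<exists>c\<in>C. F b c g = 0}" if b: "b \<in> Basis" for b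
  proof (rule thin_of_slices[where \<iota> = "\<lambda>v. rank_one v b"])
    show "open C" unfolding C_def by (intro open_Times) auto
    show "continuous_on (C \<times> UNIV) (\<lambda>(c, g). F b c g)"
      unfolding F_def adj_def case_prod_beta
      by (intro continuous_on_Pair continuous_on_sum continuous_on_scaleR continuous_on_inner
          continuous_on_perturbed continuous_on_const continuous_on_diff continuous_on_fst
          continuous_on_snd continuous_on_id)
    show "bounded_linear (\<lambda>v. rank_one v b)" by (rule bounded_linear_rank_one)
    fix g
    \<comment> \<open>the only \<open>s\<close> for which \<open>\<nu>\<close> vanishes on the range of the perturbed map at time \<open>t\<close>\<close>
    define h where "h c = - inverse (fst c * (1 - fst c)) *\<^sub>R adj g (fst c) (snd c)" for c :: "real \<times> 'w"
    let ?S = "C \<inter> {c. (0, b) \<bullet> c = 1}"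
    have "{s. \<exists>c\<in>C. F b c (g + rank_one s b) = 0} \<subseteq> h ` ?S"
    proof
      fix s assume "s \<in> {s. \<exists>c\<in>C. F b c (g + rank_one s b) = 0}"
      then obtain t \<nu> where t: "(t, \<nu>) \<in> C" and z: "adj (g + rank_one s b) t \<nu> = 0" and \<nu>: "\<nu> \<bullet> b = 1"
        unfolding F_def by (auto simp: zero_prod_def)
      have t01: "t * (1 - t) \<noteq> 0" using t unfolding C_def by auto
      have "s = h (t, \<nu>)"
      proof (rule euclidean_eqI)
        fix i :: 'v assume i: "i \<in> Basis"
        have "\<nu> \<bullet> perturbed_segment f0 f1 g t i + (t * (1 - t)) * (s \<bullet> i) = 0"
          using z i unfolding adj0 by (simp add: perturbed_segment_add inner_add_right \<nu>)
        moreover have "h (t, \<nu>) \<bullet> i = - inverse (t * (1 - t)) * (\<nu> \<bullet> perturbed_segment f0 f1 g t i)"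
          unfolding h_def adj_def using i by (simp add: inner_sum_left_Basis)
        moreover have "x = - inverse T * y" if "T \<noteq> 0" "y + T * x = 0" for x y T :: real
          using that by (simp add: field_simps add_eq_0_iff2)
        ultimately show "s \<bullet> i = h (t, \<nu>) \<bullet> i" using t01 by metis
      qed
      then show "s \<in> h ` ?S" using t \<nu> by (auto simp: inner_commute)
    qed
    moreover have "negligible (h ` ?S)"
    proof (rule negligible_differentiable_image_negligible)
      show "DIM(real \<times> 'w) \<le> DIM('v)" using dim by simp
      have "negligible {c. (0 :: real, b) \<bullet> c = 1}" by (rule negligible_hyperplane) simp
      then show "negligible ?S" by (rule negligible_subset) blast
      have "h differentiable (at c)" if "c \<in> C" for c
        unfolding h_def adj_def using that
        by (intro differentiable_scaleR differentiable_minus differentiable_inverse differentiable_mult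
            differentiable_diff differentiable_const differentiable_sum ballI differentiable_inner
            differentiable_perturbed bounded_linear_imp_differentiable bounded_linear_fst bounded_linear_snd
            finite_Basis) (auto simp: C_def)
      then show "h differentiable_on ?S" by (auto intro: differentiable_at_imp_differentiable_on)
    qed
    ultimately show "negligible {s. \<exists>c\<in>C. F b c (g + rank_one s b) = 0}"
      using negligible_subset by blast
  qed
  then have "thin (\<Union>b\<in>Basis. {g. \<exists>c\<in>C. F b c g = 0})"
    by (intro thin_UN) (auto simp: countable_finite)
  moreover have "{g. \<exists>t. 0 < t \<and> t < 1 \<and> \<not> surj (blinfun_apply (perturbed_segment f0 f1 g t))}
      \<subseteq> (\<Union>b\<in>Basis. {g. \<exists>c\<in>C. F b c g = 0})"
  proof
    fix g assume "g \<in> {g. \<exists>t. 0 < t \<and> t < 1 \<and> \<not> surj (blinfun_apply (perturbed_segment f0 f1 g t))}"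
    then obtain t where t: "0 < t" "t < 1" "\<not> surj (blinfun_apply (perturbed_segment f0 f1 g t))" by blast
    from not_surj_functional[OF t(3)] obtain \<nu> b where
      b: "b \<in> Basis" "\<nu> \<bullet> b = 1" "\<And>x. \<nu> \<bullet> perturbed_segment f0 f1 g t x = 0" by blast
    have "F b (t, \<nu>) g = 0" unfolding F_def using b adj0[of g t \<nu>] by (simp add: zero_prod_def)
    moreover have "(t, \<nu>) \<in> C" unfolding C_def using t by simp
    ultimately show "g \<in> (\<Union>b\<in>Basis. {g. \<exists>c\<in>C. F b c g = 0})" using b(1) by blast
  qed
  ultimately show ?thesis by (rule thin_subset)
qed

context manifold_chart
begin

lemma P_cont: "continuous_on U P"
  using P_deriv has_derivative_continuous by (intro continuous_at_imp_continuous_on) blast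

lemma P_differentiable: "u \<in> U \<Longrightarrow> P differentiable (at u)"
  using P_deriv unfolding differentiable_def by blast

text \<open>In the chart \<open>a \<bullet> P u = 1\<close>, so the perturbation \<open>x \<mapsto> (a \<bullet> x) w\<close> adds \<open>t (1 - t) w\<close> to
  \<open>\<gamma>(t) (P u)\<close> for \<open>t = u \<bullet> e\<close>. A zero at \<open>u\<close> therefore forces \<open>w = h u\<close>, and since
  \<open>\<gamma>(t) (P u) = t (1 - t) (w - h u)\<close>, the zero is degenerate exactly when the derivative of \<open>h\<close> is singular at
  \<open>u\<close>. The bad \<open>w\<close> are critical values of \<open>h\<close>.\<close>

lemma thin_degenerate:
  "thin {g. \<exists>u\<in>U. 0 < u \<bullet> e \<and> u \<bullet> e < 1 \<and> perturbed_segment f0 f1 g (u \<bullet> e) (P u) = 0 \<and>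
      \<not> nondegenerate_at u (perturbed_segment f0 f1 g (u \<bullet> e)) (perturbed_velocity f0 f1 g (u \<bullet> e))}"
    (is "thin ?B")
proof -
  define U' where "U' = {u \<in> U. 0 < u \<bullet> e \<and> u \<bullet> e < 1}"
  have openU': "open U'"
  proof -
    have "open {u. 0 < u \<bullet> e}" "open {u. u \<bullet> e < 1}"
      by (intro open_Collect_less continuous_on_const continuous_on_inner continuous_on_id)+
    moreover have "U' = U \<inter> ({u. 0 < u \<bullet> e} \<inter> {u. u \<bullet> e < 1})" unfolding U'_def by blast
    ultimately show ?thesis using open_U by (simp add: open_Int)
  qed
  define dF where "dF u v g = (v \<bullet> e) *\<^sub>R perturbed_velocity f0 f1 g (u \<bullet> e) (P u)
      + perturbed_segment f0 f1 g (u \<bullet> e) (P' u v)" for u v g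
  define F where "F c g = (perturbed_segment f0 f1 g (fst c \<bullet> e) (P (fst c)), dF (fst c) (snd c) g,
      snd c \<bullet> snd c - 1)" for c g
  have "thin {g. \<exists>c\<in>U' \<times> UNIV. F c g = 0}"
  proof (rule thin_of_slices[where \<iota> = "rank_one a"])
    show "open (U' \<times> (UNIV :: 'w set))" using openU' by (intro open_Times) auto
    show "bounded_linear (rank_one a :: 'w \<Rightarrow> 'v \<Rightarrow>\<^sub>L 'w)" using bounded_linear_rank_one(1) .
    let ?D = "(U' \<times> (UNIV :: 'w set)) \<times> (UNIV :: ('v \<Rightarrow>\<^sub>L 'w) set)"
    have cu: "continuous_on ?D (\<lambda>p. fst (fst p))" "continuous_on ?D (\<lambda>p. snd (fst p))"
      "continuous_on ?D (\<lambda>p. snd p)"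
      by (intro continuous_on_fst continuous_on_snd continuous_on_id)+
    have sub: "(\<lambda>p. fst (fst p)) ` ?D \<subseteq> U" unfolding U'_def by auto
    have cP: "continuous_on ?D (\<lambda>p. P (fst (fst p)))"
      by (rule continuous_on_compose2[OF P_cont cu(1) sub])
    have cP': "continuous_on ?D (\<lambda>p. P' (fst (fst p)) (snd (fst p)))"
      by (rule blinfun.continuous_on[OF continuous_on_compose2[OF P'_cont cu(1) sub] cu(2)])
    show "continuous_on ?D (\<lambda>(c, g). F c g)"
      unfolding F_def dF_def case_prod_beta
      by (intro continuous_on_Pair continuous_on_scaleR continuous_on_inner continuous_on_add
          continuous_on_perturbed continuous_on_const continuous_on_diff cu cP cP')
    fix g
    define p where "p u = (u \<bullet> e) * (1 - u \<bullet> e)" for u :: 'w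
    have p0: "p u \<noteq> 0" if "u \<in> U'" for u using that unfolding U'_def p_def by auto
    define h where "h u = - inverse (p u) *\<^sub>R perturbed_segment f0 f1 g (u \<bullet> e) (P u)" for u
    have seg: "perturbed_segment f0 f1 g (u \<bullet> e) (P u) = - (p u *\<^sub>R h u)" if "u \<in> U'" for u
      unfolding h_def using p0[OF that] by simp
    have hdiff: "h differentiable (at u)" if "u \<in> U'" for u
      unfolding h_def p_def using that p0[OF that]
      by (intro differentiable_scaleR differentiable_minus differentiable_inverse differentiable_mult
            differentiable_diff differentiable_const differentiable_inner
            differentiable_perturbed P_differentiable differentiable_ident) (auto simp: U'_def p_def)
    have hderiv: "(h has_derivative frechet_derivative h (at u)) (at u)" if "u \<in> U'" for u
      using hdiff[OF that] by (simp add: frechet_derivative_works)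
    have dF_h: "dF u v g = - ((1 - 2 * (u \<bullet> e)) * (v \<bullet> e)) *\<^sub>R h u
        - p u *\<^sub>R frechet_derivative h (at u) v" if u: "u \<in> U'" for u v
    proof -
      have uU: "u \<in> U" using u unfolding U'_def by simp
      have D1: "((\<lambda>u. perturbed_segment f0 f1 g (u \<bullet> e)) has_derivative
          (\<lambda>v. (v \<bullet> e) *\<^sub>R perturbed_velocity f0 f1 g (u \<bullet> e))) (at u)"
        by (rule has_derivative_compose[OF bounded_linear_imp_has_derivative[OF bounded_linear_inner_left]
              perturbed_segment_has_derivative[unfolded has_vector_derivative_def]])
      have L: "((\<lambda>u. perturbed_segment f0 f1 g (u \<bullet> e) (P u)) has_derivative (\<lambda>v. dF u v g)) (at u)"
        using blinfun.FDERIV[OF D1 P_deriv[OF uU]]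
        unfolding dF_def by (simp add: blinfun.bilinear_simps add.commute)
      have "(p has_derivative (\<lambda>v. (1 - 2 * (u \<bullet> e)) * (v \<bullet> e))) (at u)"
        unfolding p_def by (auto intro!: derivative_eq_intros simp: algebra_simps)
      from has_derivative_minus[OF has_derivative_scaleR[OF this hderiv[OF u]]]
      have "((\<lambda>u. - (p u *\<^sub>R h u)) has_derivative (\<lambda>v. - (p u *\<^sub>R frechet_derivative h (at u) v
          + ((1 - 2 * (u \<bullet> e)) * (v \<bullet> e)) *\<^sub>R h u))) (at u)" .
      then have "((\<lambda>u. perturbed_segment f0 f1 g (u \<bullet> e) (P u)) has_derivative
          (\<lambda>v. - (p u *\<^sub>R frechet_derivative h (at u) v
          + ((1 - 2 * (u \<bullet> e)) * (v \<bullet> e)) *\<^sub>R h u))) (at u)"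
        by (rule has_derivative_transform_within_open[OF _ openU' u]) (simp add: seg)
      from fun_cong[OF has_derivative_unique[OF L this], of v] show ?thesis by simp
    qed
    let ?S = "{u \<in> U'. \<not> inj (frechet_derivative h (at u))}"
    have "{w. \<exists>c\<in>U' \<times> UNIV. F c (g + rank_one a w) = 0} \<subseteq> h ` ?S"
    proof
      fix w assume "w \<in> {w. \<exists>c\<in>U' \<times> UNIV. F c (g + rank_one a w) = 0}"
      then obtain u v where u: "u \<in> U'"
        and z1: "perturbed_segment f0 f1 (g + rank_one a w) (u \<bullet> e) (P u) = 0"
        and z2: "dF u v (g + rank_one a w) = 0" and v: "v \<bullet> v = 1"
        unfolding F_def by (auto simp: zero_prod_def)
      have uU: "u \<in> U" using u unfolding U'_def by simp
      have "p u *\<^sub>R (w - h u) = perturbed_segment f0 f1 g (u \<bullet> e) (P u) + p u *\<^sub>R w"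
        unfolding seg[OF u] by (simp add: algebra_simps)
      also have "\<dots> = 0"
        using z1 by (simp add: perturbed_segment_add p_def P_a[OF uU])
      finally have "p u *\<^sub>R (w - h u) = 0" .
      then have w: "w = h u" using p0[OF u] by simp
      have "dF u v (g + rank_one a w) = dF u v g + ((1 - 2 * (u \<bullet> e)) * (v \<bullet> e)) *\<^sub>R w"
        unfolding dF_def using P_a[OF uU] a_P'[OF uU]
        by (simp add: perturbed_segment_add algebra_simps)
      then have "p u *\<^sub>R frechet_derivative h (at u) v = 0"
        using z2 unfolding dF_h[OF u] w by simp
      then have "frechet_derivative h (at u) v = 0" using p0[OF u] by simp
      moreover have "frechet_derivative h (at u) 0 = 0"
        using hderiv[OF u] has_derivative_linear linear_0 by blast
      moreover have "v \<noteq> 0" using v by auto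
      ultimately have "\<not> inj (frechet_derivative h (at u))" unfolding inj_def by metis
      then show "w \<in> h ` ?S" using w u by blast
    qed
    moreover have "negligible (h ` ?S)"
      by (rule Sard_euclidean[where f' = "\<lambda>u. frechet_derivative h (at u)"])
         (auto intro: has_derivative_at_withinI hderiv)
    ultimately show "negligible {w. \<exists>c\<in>U' \<times> UNIV. F c (g + rank_one a w) = 0}"
      using negligible_subset by blast
  qed
  moreover have "?B \<subseteq> {g. \<exists>c\<in>U' \<times> UNIV. F c g = 0}"
  proof
    fix g assume "g \<in> ?B"
    then obtain u where u: "u \<in> U" "0 < u \<bullet> e" "u \<bullet> e < 1"
      and z: "perturbed_segment f0 f1 g (u \<bullet> e) (P u) = 0"
      and d: "\<not> nondegenerate_at u (perturbed_segment f0 f1 g (u \<bullet> e)) (perturbed_velocity f0 f1 g (u \<bullet> e))"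
      by auto
    obtain v where v: "v \<noteq> 0" "dF u v g = 0" using d unfolding nondegenerate_at_def dF_def by auto
    define v' where "v' = inverse (norm v) *\<^sub>R v"
    have "dF u v' g = inverse (norm v) *\<^sub>R dF u v g"
      unfolding dF_def v'_def by (simp add: blinfun.bilinear_simps algebra_simps)
    moreover have "v' \<bullet> v' = 1"
      unfolding v'_def using v(1) by (simp add: dot_square_norm power2_eq_square)
    ultimately have "F (u, v') g = 0" unfolding F_def using z v(2) by (simp add: zero_prod_def)
    moreover have "(u, v') \<in> U' \<times> UNIV" using u unfolding U'_def by simp
    ultimately show "g \<in> {g. \<exists>c\<in>U' \<times> UNIV. F c g = 0}" by blast
  qed
  ultimately show ?thesis by (rule thin_subset)
qed

end

text \<open>For independent \<open>x = P1 u1\<close> and \<open>y = P2 u2\<close> the vector \<open>z = y - (a1 \<bullet> y) x\<close> is not zero, so some basis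
  vector \<open>b\<close> satisfies \<open>b \<bullet> z \<noteq> 0\<close>. The perturbations \<open>v \<mapsto> (a1 \<bullet> v) w + (b \<bullet> v) w'\<close> then move the values at
  \<open>x\<close> and \<open>y\<close> independently, and the bad \<open>(w, w')\<close> is a differentiable function of \<open>(u1, u2)\<close>. Equality
  of the two times confines \<open>(u1, u2)\<close> to a hyperplane, which is negligible.\<close>

lemma thin_double_point:
  fixes f0 f1 :: "'v::euclidean_space \<Rightarrow>\<^sub>L 'w::euclidean_space"
    and e :: 'w and P1 P2 :: "'w \<Rightarrow> 'v" and a1 a2 :: 'v
  assumes c1: "manifold_chart X a1 e U1 P1 P1' N1 R1" and c2: "manifold_chart X a2 e U2 P2 P2' N2 R2"
  shows "thin {g. \<exists>u1\<in>U1. \<exists>u2\<in>U2. 0 < u1 \<bullet> e \<and> u1 \<bullet> e < 1 \<and> u1 \<bullet> e = u2 \<bullet> e \<and>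
      span {P1 u1} \<noteq> span {P2 u2} \<and>
      perturbed_segment f0 f1 g (u1 \<bullet> e) (P1 u1) = 0 \<and> perturbed_segment f0 f1 g (u1 \<bullet> e) (P2 u2) = 0}"
    (is "thin ?B")
proof -
  interpret c1: manifold_chart X a1 e U1 P1 P1' N1 R1 by fact
  interpret c2: manifold_chart X a2 e U2 P2 P2' N2 R2 by fact
  define z where "z c = P2 (snd c) - (a1 \<bullet> P2 (snd c)) *\<^sub>R P1 (fst c)" for c :: "'w \<times> 'w"
  have cP: "continuous_on (U1 \<times> U2) (\<lambda>c. P1 (fst c))" "continuous_on (U1 \<times> U2) (\<lambda>c. P2 (snd c))"
    by (rule continuous_on_compose2[OF c1.P_cont], auto intro: continuous_on_fst continuous_on_id)
       (rule continuous_on_compose2[OF c2.P_cont], auto intro: continuous_on_snd continuous_on_id)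
  have cz: "continuous_on (U1 \<times> U2) z"
    unfolding z_def
    by (intro continuous_on_diff continuous_on_scaleR continuous_on_inner continuous_on_const cP)
  define C where "C b = {c \<in> U1 \<times> U2. 0 < fst c \<bullet> e \<and> fst c \<bullet> e < 1 \<and> b \<bullet> z c \<noteq> 0}" for b
  define F where "F c g = (perturbed_segment f0 f1 g (fst c \<bullet> e) (P1 (fst c)),
      perturbed_segment f0 f1 g (fst c \<bullet> e) (P2 (snd c)), fst c \<bullet> e - snd c \<bullet> e)" for c g
  have "thin {g. \<exists>c\<in>C b. F c g = 0}" for b
  proof (rule thin_of_slices[where \<iota> = "\<lambda>s. rank_one a1 (fst s) + rank_one b (snd s)"])
    have openU: "open (U1 \<times> U2)" using c1.open_U c2.open_U by (rule open_Times)
    have "open ((U1 \<times> U2) \<inter> (\<lambda>c. b \<bullet> z c) -` (- {0}))"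
      by (intro continuous_open_preimage continuous_on_inner continuous_on_const cz openU) auto
    moreover have "open {c :: 'w \<times> 'w. 0 < fst c \<bullet> e}" "open {c :: 'w \<times> 'w. fst c \<bullet> e < 1}"
      by (intro open_Collect_less continuous_on_const continuous_on_inner continuous_on_fst continuous_on_id)+
    ultimately have "open (((U1 \<times> U2) \<inter> (\<lambda>c. b \<bullet> z c) -` (- {0})) \<inter>
        ({c. 0 < fst c \<bullet> e} \<inter> {c. fst c \<bullet> e < 1}))"
      by (rule open_Int[OF _ open_Int])
    moreover have "C b = ((U1 \<times> U2) \<inter> (\<lambda>c. b \<bullet> z c) -` (- {0})) \<inter>
        ({c. 0 < fst c \<bullet> e} \<inter> {c. fst c \<bullet> e < 1})" unfolding C_def by auto
    ultimately show "open (C b)" by simp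
    show "bounded_linear (\<lambda>s. rank_one a1 (fst s) + rank_one b (snd s) :: 'v \<Rightarrow>\<^sub>L 'w)"
      by (intro bounded_linear_add bounded_linear_compose[OF bounded_linear_rank_one(1)]
          bounded_linear_fst bounded_linear_snd)
    let ?D = "C b \<times> (UNIV :: ('v \<Rightarrow>\<^sub>L 'w) set)"
    have cc: "continuous_on ?D fst" "continuous_on ?D snd"
      by (intro continuous_on_fst continuous_on_snd continuous_on_id)+
    have sub: "fst ` ?D \<subseteq> U1 \<times> U2" unfolding C_def by auto
    note cP' = continuous_on_compose2[OF cP(1) cc(1) sub] continuous_on_compose2[OF cP(2) cc(1) sub]
    show "continuous_on ?D (\<lambda>(c, g). F c g)"
      unfolding F_def case_prod_beta
      by (intro continuous_on_Pair continuous_on_inner continuous_on_perturbed continuous_on_const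
          continuous_on_diff cP' continuous_on_fst continuous_on_snd continuous_on_id)
    fix g
    define p where "p c = (fst c \<bullet> e) * (1 - fst c \<bullet> e)" for c :: "'w \<times> 'w"
    have p0: "p c \<noteq> 0" "b \<bullet> z c \<noteq> 0" if "c \<in> C b" for c using that unfolding C_def p_def by auto
    define h2 where "h2 c = - inverse (p c * (b \<bullet> z c)) *\<^sub>R perturbed_segment f0 f1 g (fst c \<bullet> e) (z c)" for c
    define h1 where "h1 c = - inverse (p c) *\<^sub>R perturbed_segment f0 f1 g (fst c \<bullet> e) (P1 (fst c))
        - (b \<bullet> P1 (fst c)) *\<^sub>R h2 c" for c
    let ?S = "C b \<inter> {c. (e, - e) \<bullet> c = 0}"
    have "{s. \<exists>c\<in>C b. F c (g + (rank_one a1 (fst s) + rank_one b (snd s))) = 0} \<subseteq> (\<lambda>c. (h1 c, h2 c)) ` ?S"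
    proof
      fix s assume "s \<in> {s. \<exists>c\<in>C b. F c (g + (rank_one a1 (fst s) + rank_one b (snd s))) = 0}"
      then obtain c w w' where c: "c \<in> C b" and s: "s = (w, w')"
        and F0: "F c (g + (rank_one a1 w + rank_one b w')) = 0" by (cases s) auto
      have a1: "a1 \<bullet> P1 (fst c) = 1" using c c1.P_a unfolding C_def by auto
      have F': "perturbed_segment f0 f1 (g + (rank_one a1 w + rank_one b w')) (fst c \<bullet> e) (P1 (fst c)) = 0"
        "perturbed_segment f0 f1 (g + (rank_one a1 w + rank_one b w')) (fst c \<bullet> e) (P2 (snd c)) = 0"
        and te: "fst c \<bullet> e = snd c \<bullet> e"
        using F0 unfolding F_def zero_prod_def prod.inject right_minus_eq by blast+
      have z1: "perturbed_segment f0 f1 g (fst c \<bullet> e) (P1 (fst c)) + p c *\<^sub>R (w + (b \<bullet> P1 (fst c)) *\<^sub>R w') = 0"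
        and z2: "perturbed_segment f0 f1 g (fst c \<bullet> e) (P2 (snd c))
          + p c *\<^sub>R ((a1 \<bullet> P2 (snd c)) *\<^sub>R w + (b \<bullet> P2 (snd c)) *\<^sub>R w') = 0"
        using F' by (simp_all only: perturbed_segment_add blinfun.add_left rank_one_apply a1 p_def scaleR_one)
      have solve: "x = - inverse q *\<^sub>R y" if "y = - (q *\<^sub>R x)" "q \<noteq> 0" for x y :: 'w and q :: real
        using that by simp
      have "perturbed_segment f0 f1 g (fst c \<bullet> e) (z c) + (p c * (b \<bullet> z c)) *\<^sub>R w' =
          (perturbed_segment f0 f1 g (fst c \<bullet> e) (P2 (snd c))
          + p c *\<^sub>R ((a1 \<bullet> P2 (snd c)) *\<^sub>R w + (b \<bullet> P2 (snd c)) *\<^sub>R w'))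
          - (a1 \<bullet> P2 (snd c)) *\<^sub>R (perturbed_segment f0 f1 g (fst c \<bullet> e) (P1 (fst c))
          + p c *\<^sub>R (w + (b \<bullet> P1 (fst c)) *\<^sub>R w'))"
        unfolding z_def
        by (simp add: blinfun.bilinear_simps algebra_simps inner_diff_right)
      then have "perturbed_segment f0 f1 g (fst c \<bullet> e) (z c) = - ((p c * (b \<bullet> z c)) *\<^sub>R w')"
        unfolding z1 z2 by (simp add: eq_neg_iff_add_eq_0)
      then have w': "w' = h2 c" unfolding h2_def by (rule solve) (use p0[OF c] in simp)
      have "perturbed_segment f0 f1 g (fst c \<bullet> e) (P1 (fst c)) = - (p c *\<^sub>R (w + (b \<bullet> P1 (fst c)) *\<^sub>R w'))"
        using z1 by (simp add: eq_neg_iff_add_eq_0)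
      then have "w = h1 c" unfolding h1_def w'[symmetric] using p0[OF c] by simp
      then show "s \<in> (\<lambda>c. (h1 c, h2 c)) ` ?S"
        using s w' c te by (auto simp: inner_prod_def inner_commute intro!: image_eqI[of _ _ c])
    qed
    moreover have "negligible ((\<lambda>c. (h1 c, h2 c)) ` ?S)"
    proof (rule negligible_differentiable_image_negligible)
      have "e \<noteq> 0" using c1.norm_e by auto
      then have "negligible {c. (e, - e) \<bullet> c = 0}" by (intro negligible_hyperplane) (simp add: zero_prod_def)
      then show "negligible ?S" by (rule negligible_subset) blast
      have "(\<lambda>c. (h1 c, h2 c)) differentiable (at c)" if c: "c \<in> C b" for c
      proof -
        have cU: "fst c \<in> U1" "snd c \<in> U2" using c unfolding C_def by auto
        have dP1: "(\<lambda>c. P1 (fst c)) differentiable (at c)"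
          using has_derivative_compose[OF bounded_linear_imp_has_derivative[OF bounded_linear_fst] c1.P_deriv[OF cU(1)]]
          unfolding differentiable_def by blast
        have dP2: "(\<lambda>c. P2 (snd c)) differentiable (at c)"
          using has_derivative_compose[OF bounded_linear_imp_has_derivative[OF bounded_linear_snd] c2.P_deriv[OF cU(2)]]
          unfolding differentiable_def by blast
        have dt: "(\<lambda>c. fst c \<bullet> e) differentiable (at c)"
          by (intro differentiable_inner differentiable_const bounded_linear_imp_differentiable bounded_linear_fst)
        have dz: "z differentiable (at c)"
          unfolding z_def
          by (intro differentiable_diff differentiable_scaleR differentiable_inner differentiable_const dP1 dP2)
        have dp: "p differentiable (at c)"
          unfolding p_def by (intro differentiable_mult differentiable_diff differentiable_const dt)
        have dh2: "h2 differentiable (at c)"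
          unfolding h2_def using p0[OF c]
          by (intro differentiable_scaleR differentiable_minus differentiable_inverse differentiable_mult
              differentiable_inner differentiable_const differentiable_perturbed dt dz dp) auto
        have dh1: "h1 differentiable (at c)"
          unfolding h1_def using p0[OF c]
          by (intro differentiable_diff differentiable_scaleR differentiable_minus differentiable_inverse
              differentiable_inner differentiable_const differentiable_perturbed dt dp dP1 dh2) auto
        show ?thesis using dh1 dh2 has_derivative_Pair unfolding differentiable_def by blast
      qed
      then show "(\<lambda>c. (h1 c, h2 c)) differentiable_on ?S"
        by (auto intro: differentiable_at_imp_differentiable_on)
    qed simp
    ultimately show "negligible {s. \<exists>c\<in>C b. F c (g + (rank_one a1 (fst s) + rank_one b (snd s))) = 0}"
      using negligible_subset by blast
  qed
  then have "thin (\<Union>b\<in>Basis. {g. \<exists>c\<in>C b. F c g = 0})"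
    by (intro thin_UN) (auto simp: countable_finite)
  moreover have "?B \<subseteq> (\<Union>b\<in>Basis. {g. \<exists>c\<in>C b. F c g = 0})"
  proof
    fix g assume "g \<in> ?B"
    then obtain u1 u2 where u: "u1 \<in> U1" "u2 \<in> U2" "0 < u1 \<bullet> e" "u1 \<bullet> e < 1" "u1 \<bullet> e = u2 \<bullet> e"
      and ne: "span {P1 u1} \<noteq> span {P2 u2}"
      and s: "perturbed_segment f0 f1 g (u1 \<bullet> e) (P1 u1) = 0" "perturbed_segment f0 f1 g (u1 \<bullet> e) (P2 u2) = 0"
      by (elim CollectE bexE conjE) (rule that; assumption)
    have "z (u1, u2) \<noteq> 0"
    proof
      assume "z (u1, u2) = 0"
      then have eq: "P2 u2 = (a1 \<bullet> P2 u2) *\<^sub>R P1 u1" unfolding z_def by simp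
      then have "a1 \<bullet> P2 u2 \<noteq> 0" using c2.P_nonzero[OF u(2)] by auto
      then have "span {P2 u2} = span {P1 u1}" using eq span_scale_singleton by metis
      then show False using ne by simp
    qed
    then obtain b where b: "b \<in> Basis" "b \<bullet> z (u1, u2) \<noteq> 0"
      using euclidean_all_zero_iff[of "z (u1, u2)"] by (auto simp: inner_commute)
    have "(u1, u2) \<in> C b" unfolding C_def using u b(2) by simp
    moreover have "F (u1, u2) g = 0" unfolding F_def using s u(5) by (simp add: zero_prod_def)
    ultimately show "g \<in> (\<Union>b\<in>Basis. {g. \<exists>c\<in>C b. F c g = 0})" using b(1) by blast
  qed
  ultimately show ?thesis by (rule thin_subset)
qed

section \<open>Crossing the wall\<close>

context manifold_chart
begin

lemma chart_covers:
  assumes "a \<bullet> y \<noteq> 0" and "inverse (a \<bullet> y) *\<^sub>R y \<in> N" and "span {y} \<in> X"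
  shows "\<exists>u\<in>U. u \<bullet> e = t \<and> span {P u} = span {y}"
proof -
  let ?z = "inverse (a \<bullet> y) *\<^sub>R y"
  have az: "a \<bullet> ?z = 1" and span: "span {?z} = span {y}"
    using assms(1) by (simp_all add: span_scale_singleton)
  have zX: "span {?z} \<in> X" using assms(3) span by simp
  let ?u = "R ?z + (t - R ?z \<bullet> e) *\<^sub>R e"
  note RU = R_U[OF assms(2) az zX]
  have "?u \<in> U" using U_cyl[OF RU] .
  moreover have "P ?u = ?z" using P_cyl[OF RU] P_R[OF assms(2) az zX] by simp
  moreover have "?u \<bullet> e = t" using norm_e by (simp add: inner_add_left norm_eq_1)
  ultimately show ?thesis using span by (intro bexI[of _ ?u]) simp_all
qed

text \<open>Transversality: a curve in the wall with velocity \<open>D\<close> would have to leave the wall immediately.\<close>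

lemma regular_crossing:
  fixes f :: "real \<Rightarrow> 'v \<Rightarrow>\<^sub>L 'w"
  assumes X: "compactin proj_topology X" and u: "u \<in> U"
    and surj: "surj (blinfun_apply (f t0))"
    and ker: "X \<inter> proj (ker (f t0)) = {span {P u}}"
    and nd: "nondegenerate_at u (f t0) D"
  shows "regular_point X (f t0)" and "D \<notin> tangent_space (wall X) (f t0)"
proof -
  have "P u \<in> ker (f t0)"
  proof -
    have "span {P u} \<in> proj (ker (f t0))" using ker by blast
    then show ?thesis by (simp add: span_in_proj_iff[OF P_nonzero[OF u] subspace_ker])
  qed
  then have fP: "f t0 (P u) = 0" by (simp add: ker_def)
  have "f t0 \<in> wall X" using ker unfolding wall_def Hom_X_def by blast
  moreover have "ker (f t0) \<inter> Y_fibre X (span {P u}) = span {P u}"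
    unfolding Y_fibre_chart[OF u] by (rule kernel_meets_cone_tangent_space[OF u fP nd])
  ultimately show "regular_point X (f t0)"
    unfolding regular_point_def using surj ker by blast
  show "D \<notin> tangent_space (wall X) (f t0)"
  proof
    assume "D \<in> tangent_space (wall X) (f t0)"
    then obtain c \<epsilon> where c: "D = vector_derivative c (at 0)" "c 0 = f t0"
      and \<epsilon>: "\<epsilon> > 0" "smooth_on {-\<epsilon><..<\<epsilon>} c" "c ` {-\<epsilon><..<\<epsilon>} \<subseteq> wall X"
      unfolding tangent_space_def by blast
    have "(c has_vector_derivative D) (at 0)"
      using smooth_on_interval_has_vector_derivative[OF \<epsilon>(2,1)] c(1) by simp
    from eventually_off_wall[OF X u this] ker nd c(2)
    have "\<forall>\<^sub>F t in at 0. c t \<notin> wall X" by simp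
    moreover have "\<forall>\<^sub>F t in at 0. t \<in> {-\<epsilon><..<\<epsilon>}"
      using \<epsilon>(1) by (intro eventually_at_in_open') auto
    ultimately have "\<forall>\<^sub>F t in at (0::real). False"
      by eventually_elim (use \<epsilon>(3) in blast)
    then show False by simp
  qed
qed

end

text \<open>The set of crossing times is compact, and none of them is a limit of others.\<close>

lemma finite_wall_crossings:
  fixes \<gamma> :: "real \<Rightarrow> 'v::euclidean_space \<Rightarrow>\<^sub>L 'w::euclidean_space"
  assumes X: "compactin proj_topology X" and cont: "continuous_on UNIV \<gamma>"
    and iso: "\<And>t. t \<in> {0..1} \<Longrightarrow> \<gamma> t \<in> wall X \<Longrightarrow> \<forall>\<^sub>F s in at t. \<gamma> s \<notin> wall X"
  shows "finite {t \<in> {0..1}. \<gamma> t \<in> wall X}"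
proof (rule ccontr)
  let ?T = "{t \<in> {0..1}. \<gamma> t \<in> wall X}"
  assume inf: "infinite ?T"
  have sub: "X \<subseteq> proj UNIV"
    using compactin_subset_topspace[OF X] openin_proj_topology[of "topspace proj_topology"] by auto
  have "continuous_on (unit_cone X \<times> UNIV) (\<lambda>p. \<gamma> (snd p) (fst p))"
    by (intro blinfun.continuous_on continuous_on_compose2[OF cont] continuous_on_fst continuous_on_snd
        continuous_on_id) auto
  from compact_projection_closed[OF compact_unit_cone[OF X] this]
  have "closed {t. \<exists>x\<in>unit_cone X. \<gamma> t x = 0}" by simp
  then have "closed {t. \<gamma> t \<in> wall X}" by (simp add: wall_iff_unit_cone[OF sub])
  from compact_Int_closed[OF compact_Icc[of 0 1] this] have "compact ({0..1} \<inter> {t. \<gamma> t \<in> wall X})" .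
  moreover have "{0..1} \<inter> {t. \<gamma> t \<in> wall X} = ?T" by blast
  ultimately have "compact ?T" by simp
  then obtain t where "t \<in> ?T" "t islimpt ?T"
    using inf Heine_Borel_imp_Bolzano_Weierstrass by blast
  moreover from this have "\<forall>\<^sub>F s in at t. s \<notin> ?T"
    using iso[of t] by (auto elim: eventually_mono)
  ultimately show False by (simp add: islimpt_iff_eventually)
qed

theorem corollary2p18:
  fixes X :: "'v::euclidean_space set set" and m :: nat
    and f0 f1 :: "'v \<Rightarrow>\<^sub>L 'w::euclidean_space"
  assumes "compactin proj_topology X" and "proj_submanifold m X"
    and "m < DIM('v) - 1" and "DIM('w) = m + 1"
    and "f0 \<in> Hom_X X" and "f1 \<in> Hom_X X"
  shows "\<exists>\<gamma> :: real \<Rightarrow> 'v \<Rightarrow>\<^sub>L 'w.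
    smooth_on {0..1} \<gamma> \<and> \<gamma> 0 = f0 \<and> \<gamma> 1 = f1 \<and>
    finite {t \<in> {0..1}. \<gamma> t \<in> wall X} \<and>
    (\<forall>t\<in>{0..1}. \<gamma> t \<in> wall X \<longrightarrow>
       regular_point X (\<gamma> t) \<and>
       vector_derivative \<gamma> (at t within {0..1}) \<notin> tangent_space (wall X) (\<gamma> t))"
proof -
  obtain e :: 'w where "e \<in> Basis" using nonempty_Basis by blast
  then have e: "norm e = 1" by simp
  have sub: "X \<subseteq> proj UNIV" using assms(2) unfolding proj_submanifold_def by blast
  let ?S = "unit_cone X"
  have "\<forall>x\<in>?S. \<exists>q. case q of (U, P, P', N, R) \<Rightarrow> manifold_chart X x e U P P' N R \<and> x \<in> N"
  proof
    fix x assume "x \<in> ?S"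
    then have "x \<bullet> x = 1" "span {x} \<in> X" unfolding unit_cone_def by (auto simp: norm_eq_1)
    from manifold_chart_exists[OF assms(2,4) e this]
    show "\<exists>q. case q of (U, P, P', N, R) \<Rightarrow> manifold_chart X x e U P P' N R \<and> x \<in> N" by auto
  qed
  from bchoice[OF this] obtain q where
    q: "\<forall>x\<in>?S. case q x of (U, P, P', N, R) \<Rightarrow> manifold_chart X x e U P P' N R \<and> x \<in> N" ..
  define U where "U x = fst (q x)" for x
  define P where "P x = fst (snd (q x))" for x
  define P' where "P' x = fst (snd (snd (q x)))" for x
  define N where "N x = fst (snd (snd (snd (q x))))" for x
  define R where "R x = snd (snd (snd (snd (q x))))" for x
  have chart: "manifold_chart X x e (U x) (P x) (P' x) (N x) (R x)" and xN: "x \<in> N x" if "x \<in> ?S" for x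
    using bspec[OF q that] unfolding U_def P_def P'_def N_def R_def by (auto simp: case_prod_beta)
  \<comment> \<open>lines whose representative in the affine chart of \<open>x\<close> lies in the domain of the inverse chart\<close>
  define V where "V x = {y. x \<bullet> y \<noteq> 0} \<inter> (\<lambda>y. inverse (x \<bullet> y) *\<^sub>R y) -` N x" for x
  have openV: "open (V x)" if "x \<in> ?S" for x
  proof -
    interpret manifold_chart X x e "U x" "P x" "P' x" "N x" "R x" by (rule chart[OF that])
    have "open {y. x \<bullet> y \<noteq> 0}"
      by (intro open_Collect_neq continuous_on_inner continuous_on_const continuous_on_id)
    then show ?thesis
      unfolding V_def
      by (intro continuous_open_preimage continuous_on_scaleR continuous_on_inverse continuous_on_inner
          continuous_on_const continuous_on_id open_N) auto
  qed
  have "x \<in> V x" if "x \<in> ?S" for x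
  proof -
    have "x \<bullet> x = 1" using that unfolding unit_cone_def by (simp add: norm_eq_1)
    then show ?thesis using xN[OF that] unfolding V_def by simp
  qed
  then have "?S \<subseteq> (\<Union>x\<in>?S. V x)" by blast
  from compactE_image[OF compact_unit_cone[OF assms(1)] openV this]
  obtain T where T: "T \<subseteq> ?S" "finite T" "?S \<subseteq> (\<Union>x\<in>T. V x)" .
  have cover: "\<exists>x\<in>T. \<exists>u\<in>U x. u \<bullet> e = t \<and> span {P x u} = l"
    if l: "l \<in> X" for l t
  proof -
    obtain y where y: "norm y = 1" "l = span {y}" using sub l proj_unit_vector by blast
    then have "y \<in> ?S" using l unfolding unit_cone_def by simp
    then obtain x where x: "x \<in> T" "y \<in> V x" using T(3) by blast
    then have "x \<in> ?S" using T(1) by blast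
    from manifold_chart.chart_covers[OF chart[OF this], of y t]
    show ?thesis using x l y(2) unfolding V_def by auto
  qed
  let ?seg = "perturbed_segment f0 f1" and ?vel = "perturbed_velocity f0 f1"
  \<comment> \<open>finitely many charts cover \<open>X\<close>, so finitely many thin sets have to be avoided\<close>
  define B1 where "B1 = {g. \<exists>t. 0 < t \<and> t < 1 \<and> \<not> surj (blinfun_apply (?seg g t))}"
  define B2 where "B2 x = {g. \<exists>u\<in>U x. 0 < u \<bullet> e \<and> u \<bullet> e < 1 \<and> ?seg g (u \<bullet> e) (P x u) = 0 \<and>
      \<not> manifold_chart.nondegenerate_at e (P x) (P' x) u (?seg g (u \<bullet> e)) (?vel g (u \<bullet> e))}" for x
  define B3 where "B3 x y = {g. \<exists>u1\<in>U x. \<exists>u2\<in>U y. 0 < u1 \<bullet> e \<and> u1 \<bullet> e < 1 \<and> u1 \<bullet> e = u2 \<bullet> e \<and>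
      span {P x u1} \<noteq> span {P y u2} \<and>
      ?seg g (u1 \<bullet> e) (P x u1) = 0 \<and> ?seg g (u1 \<bullet> e) (P y u2) = 0}" for x y
  have "thin B1" unfolding B1_def using assms(3,4) by (intro thin_not_surjective) simp
  moreover have "thin (B2 x)" if "x \<in> T" for x
    unfolding B2_def using T(1) that by (intro manifold_chart.thin_degenerate[OF chart]) blast
  moreover have "thin (B3 x y)" if "x \<in> T" "y \<in> T" for x y
    unfolding B3_def using T(1) that by (intro thin_double_point[OF chart chart]) blast+
  ultimately have "thin (B1 \<union> (\<Union>x\<in>T. B2 x) \<union> (\<Union>x\<in>T. \<Union>y\<in>T. B3 x y))"
    by (intro thin_Un thin_UN countable_finite T(2)) auto
  then have "B1 \<union> (\<Union>x\<in>T. B2 x) \<union> (\<Union>x\<in>T. \<Union>y\<in>T. B3 x y) \<noteq> UNIV"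
    using not_thin_UNIV by metis
  then obtain g where "g \<notin> B1 \<union> (\<Union>x\<in>T. B2 x) \<union> (\<Union>x\<in>T. \<Union>y\<in>T. B3 x y)"
    using UNIV_eq_I by metis
  then have g: "g \<notin> B1" "\<And>x. x \<in> T \<Longrightarrow> g \<notin> B2 x"
    "\<And>x y. x \<in> T \<Longrightarrow> y \<in> T \<Longrightarrow> g \<notin> B3 x y" by simp_all
  let ?\<gamma> = "?seg g"
  have crossing: "\<exists>x\<in>T. \<exists>u\<in>U x. surj (blinfun_apply (?\<gamma> t)) \<and> X \<inter> proj (ker (?\<gamma> t)) = {span {P x u}} \<and>
      manifold_chart.nondegenerate_at e (P x) (P' x) u (?\<gamma> t) (?vel g t)"
    if t: "t \<in> {0..1}" "?\<gamma> t \<in> wall X" for t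
  proof -
    have "t \<noteq> 0" "t \<noteq> 1"
      using t(2) assms(5,6) perturbed_segment_ends[of f0 f1 g] unfolding wall_def by auto
    then have t01: "0 < t" "t < 1" using t(1) by auto
    obtain l where l: "l \<in> X" "l \<in> proj (ker (?\<gamma> t))" using t(2) unfolding wall_def Hom_X_def by blast
    obtain x u where x: "x \<in> T" "u \<in> U x" "u \<bullet> e = t" "span {P x u} = l"
      using cover[OF l(1), of t] by (elim bexE conjE) (rule that; assumption)
    have kerP: "?\<gamma> t (P y v) = 0" if "span {P y v} \<in> proj (ker (?\<gamma> t))" for y v
    proof -
      have "P y v \<in> ker (?\<gamma> t)" using that span_base[of "P y v" "{P y v}"] unfolding proj_def by auto
      then show ?thesis by (simp add: ker_def)
    qed
    have unique: "k = l" if k: "k \<in> X" "k \<in> proj (ker (?\<gamma> t))" for k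
    proof (rule ccontr)
      assume "k \<noteq> l"
      obtain y v where y: "y \<in> T" "v \<in> U y" "v \<bullet> e = t" "span {P y v} = k"
        using cover[OF k(1), of t] by (elim bexE conjE) (rule that; assumption)
      have zero: "?\<gamma> t (P x u) = 0" "?\<gamma> t (P y v) = 0"
        by (rule kerP, simp only: x(4) l(2)) (rule kerP, simp only: y(4) k(2))
      have "g \<in> B3 x y"
        unfolding B3_def mem_Collect_eq
      proof (rule bexI[OF _ x(2)], rule bexI[OF _ y(2)])
        show "0 < u \<bullet> e \<and> u \<bullet> e < 1 \<and> u \<bullet> e = v \<bullet> e \<and> span {P x u} \<noteq> span {P y v} \<and>
            ?\<gamma> (u \<bullet> e) (P x u) = 0 \<and> ?\<gamma> (u \<bullet> e) (P y v) = 0"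
          unfolding x(3,4) y(3,4) using t01 \<open>k \<noteq> l\<close> zero by simp
      qed
      then show False using g(3) x(1) y(1) by blast
    qed
    have "X \<inter> proj (ker (?\<gamma> t)) = {span {P x u}}"
      unfolding x(4)
    proof (intro equalityI subsetI)
      show "k \<in> {l}" if "k \<in> X \<inter> proj (ker (?\<gamma> t))" for k
        unfolding singleton_iff by (rule unique) (use that in simp_all)
      show "k \<in> X \<inter> proj (ker (?\<gamma> t))" if "k \<in> {l}" for k
        using that l by simp
    qed
    moreover have "surj (blinfun_apply (?\<gamma> t))"
    proof (rule ccontr)
      assume "\<not> surj (blinfun_apply (?\<gamma> t))"
      then have "g \<in> B1" unfolding B1_def using t01 by (intro CollectI exI[of _ t] conjI)
      then show False using g(1) by simp
    qed
    moreover have "manifold_chart.nondegenerate_at e (P x) (P' x) u (?\<gamma> t) (?vel g t)"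
    proof (rule ccontr)
      assume "\<not> manifold_chart.nondegenerate_at e (P x) (P' x) u (?\<gamma> t) (?vel g t)"
      then have "g \<in> B2 x"
        unfolding B2_def mem_Collect_eq using t01 kerP[of x u] l(2) x(2-4)
        by (intro bexI[OF _ x(2)] conjI) simp_all
      then show False using g(2) x(1) by blast
    qed
    ultimately show ?thesis using x by (intro bexI[of _ x] bexI[of _ u] conjI)
  qed
  have deriv: "(?\<gamma> has_vector_derivative ?vel g t) (at t)" for t
    by (rule perturbed_segment_has_derivative)
  have "continuous_on UNIV ?\<gamma>"
    by (rule continuous_at_imp_continuous_on) (rule ballI, rule has_vector_derivative_continuous[OF deriv])
  then have finite: "finite {t \<in> {0..1}. ?\<gamma> t \<in> wall X}"
  proof (rule finite_wall_crossings[OF assms(1)])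
    fix t :: real assume t: "t \<in> {0..1}" "?\<gamma> t \<in> wall X"
    obtain x u where x: "x \<in> T" "u \<in> U x" and c: "X \<inter> proj (ker (?\<gamma> t)) = {span {P x u}}"
      "manifold_chart.nondegenerate_at e (P x) (P' x) u (?\<gamma> t) (?vel g t)"
      using crossing[OF t] by (elim bexE conjE) (rule that; assumption)
    have xS: "x \<in> ?S" using x(1) T(1) by (rule subsetD[rotated])
    show "\<forall>\<^sub>F s in at t. ?\<gamma> s \<notin> wall X"
      by (rule manifold_chart.eventually_off_wall[OF chart[OF xS] assms(1) x(2) deriv c])
  qed
  have regular: "regular_point X (?\<gamma> t) \<and>
      vector_derivative ?\<gamma> (at t within {0..1}) \<notin> tangent_space (wall X) (?\<gamma> t)"
    if t: "t \<in> {0..1}" "?\<gamma> t \<in> wall X" for t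
  proof
    obtain x u where x: "x \<in> T" "u \<in> U x" and c: "surj (blinfun_apply (?\<gamma> t))"
      "X \<inter> proj (ker (?\<gamma> t)) = {span {P x u}}"
      "manifold_chart.nondegenerate_at e (P x) (P' x) u (?\<gamma> t) (?vel g t)"
      using crossing[OF t] by (elim bexE conjE) (rule that; assumption)
    have xS: "x \<in> ?S" using x(1) T(1) by (rule subsetD[rotated])
    show "regular_point X (?\<gamma> t)"
      by (rule manifold_chart.regular_crossing(1)[where f = ?\<gamma>, OF chart[OF xS] assms(1) x(2) c])
    have "?vel g t \<notin> tangent_space (wall X) (?\<gamma> t)"
      by (rule manifold_chart.regular_crossing(2)[where f = ?\<gamma>, OF chart[OF xS] assms(1) x(2) c])
    moreover have "vector_derivative ?\<gamma> (at t within {0..1}) = ?vel g t"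
    proof (rule vector_derivative_within[OF _ has_vector_derivative_at_within[OF deriv]])
      show "at t within {0..1} \<noteq> bot"
        using t(1) by (simp add: trivial_limit_within)
    qed
    ultimately show "vector_derivative ?\<gamma> (at t within {0..1}) \<notin> tangent_space (wall X) (?\<gamma> t)"
      by simp
  qed
  show ?thesis
    using smooth_perturbed_segment perturbed_segment_ends finite regular
    by (intro exI[of _ ?\<gamma>] conjI ballI impI) simp_all
qed

end
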